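(* Let $\mathbb X$ and $\mathbb Y$ be Banach spaces, $C\subseteq\mathbb X$ and $F:C\to\mathbb Y$ a continuous function, analytic on $\mathrm{int}(C)$. Take $x_0\in\mathrm{int}(C)$ with $F'(x_0)$ non-singular and define $\gamma:=\sup_{n>1}\big\|\frac{F'(x_0)^{-1}F^{(n)}(x_0)}{n!}\big\|^{1/(n-1)}$. Suppose $B(x_0,1/\gamma)\subset C$, $b>0$, and \[\|F'(x_0)^{-1}F(x_0)\|\le b,\qquad b\gamma<3-2\sqrt2,\qquad 0\le\theta\le\frac{1-2\sqrt{\gamma b}-\gamma b}{1+2\sqrt{\gamma b}+\gamma b}.\] Then the inexact Newton method with starting point $x_0$ and relative residual error tolerance $\theta$: for $k=0,1,\dots$, $x_{k+1}=x_k+S_k$ with $\|F'(x_0)^{-1}[F(x_k)+F'(x_k)S_k]\|\le\theta\|F'(x_0)^{-1}F(x_k)\|$, is well defined; any generated sequence $\{x_k\}$ converges to a zero $x_*$ of $F$, satisfies $\|F'(x_0)^{-1}F(x_k)\|\le(\frac{1+\theta^2}{2})^k b$ for $k=0,1,\dots$, and is contained in $B(x_0,\lambda)$; moreover $x_*\in B[x_0,t_*]$ and $x_*$ is the unique zero of $F$ in $B(x_0,\bar\tau)$, where \[\lambda:=\frac{b}{\sqrt{\gamma b}+\gamma b},\quad t_*:=\frac{1+\gamma b-\sqrt{1-6\gamma b+(\gamma b)^2}}{4\gamma},\quad \bar\tau:=\frac{1+\gamma b+\sqrt{1-6\gamma b+(\gamma b)^2}}{4\gamma}.\] Moreover, for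 $k=0,1,\dots$, \[\|x_*-x_{k+1}\|\le\Big[\frac{1+\theta}{2}\frac{D^-f'(\lambda)}{|f'(\lambda)|}\|x_*-x_k\|+\theta\,\frac{f'(\lambda)+2}{|f'(\lambda)|}\Big]\|x_*-x_k\|,\] and if additionally $0\le\theta<(1-2\sqrt{\gamma b}-\gamma b)/(5-2\sqrt{\gamma b}-\gamma b)$, then \[\|x_*-x_{k+1}\|\le\Big[\frac{1+\theta}{2}+\frac{2\theta}{1-2\sqrt{\gamma b}-\gamma b}\Big]\|x_*-x_k\|,\qquad k=0,1,\dots.\]
   Context: $B(x,r)$, $B[x,r]$ are open/closed balls. Here $f:[0,1/\gamma)\to\mathbb R$ is the function $f(t)=\frac{t}{1-\gamma t}-2t+b$, and $D^-f'(\lambda)$ is the left derivative of $f'$ at $\lambda$. *)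

theory Defs
  imports "HOL-Analysis.Analysis"
begin

text \<open>Multilinear maps of arity n are represented as functions on lists
  (only lists of length n matter).  M is linear in each argument slot.\<close>
definition multilinear :: "nat \<Rightarrow> ('a::real_vector list \<Rightarrow> 'b::real_vector) \<Rightarrow> bool" where
  "multilinear n M \<longleftrightarrow>
     (\<forall>xs ys. length xs + length ys + 1 = n \<longrightarrow> linear (\<lambda>h. M (xs @ h # ys)))"

definition bounded_multilinear ::
  "nat \<Rightarrow> ('a::real_normed_vector list \<Rightarrow> 'b::real_normed_vector) \<Rightarrow> bool" where
  "bounded_multilinear n M \<longleftrightarrow> multilinear n M \<and>
     (\<exists>K. \<forall>hs. length hs = n \<longrightarrow> norm (M hs) \<le> K * prod_list (map norm hs))"

definition mnorm :: "nat \<Rightarrow> ('a::real_normed_vector list \<Rightarrow> 'b::real_normed_vector) \<Rightarrow> real" where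
  "mnorm n M = (SUP hs \<in> {hs. length hs = n \<and> (\<forall>h\<in>set hs. norm h \<le> 1)}. norm (M hs))"

text \<open>D n x is the n-th Frechet derivative of F at x (D 0 x [] = F x), each
  D (Suc n) being the Frechet derivative (in operator norm) of y \<mapsto> D n y:
  D (Suc n) x (h # hs) = (D n)'(x) h applied to hs.\<close>
definition has_higher_derivs ::
  "('a::real_normed_vector \<Rightarrow> 'b::real_normed_vector) \<Rightarrow> (nat \<Rightarrow> 'a \<Rightarrow> 'a list \<Rightarrow> 'b) \<Rightarrow> 'a set \<Rightarrow> bool" where
  "has_higher_derivs F D S \<longleftrightarrow>
     (\<forall>x\<in>S. D 0 x [] = F x \<and> (\<forall>n. bounded_multilinear n (D n x)) \<and>
        (\<forall>n. \<forall>e>0. \<exists>d>0. \<forall>y\<in>ball x d \<inter> S. \<forall>hs. length hs = n \<longrightarrow>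
            norm (D n y hs - D n x hs - D (Suc n) x ((y - x) # hs))
              \<le> e * norm (y - x) * prod_list (map norm hs)))"

definition analytic_with_derivs ::
  "('a::real_normed_vector \<Rightarrow> 'b::real_normed_vector) \<Rightarrow> (nat \<Rightarrow> 'a \<Rightarrow> 'a list \<Rightarrow> 'b) \<Rightarrow> 'a set \<Rightarrow> bool" where
  "analytic_with_derivs F D S \<longleftrightarrow> has_higher_derivs F D S \<and>
     (\<forall>x\<in>S. \<exists>r>0. ball x r \<subseteq> S \<and>
        summable (\<lambda>n. mnorm n (D n x) * r ^ n / fact n) \<and>
        (\<forall>y\<in>ball x r. (\<lambda>n. (1 / fact n) *\<^sub>R D n x (replicate n (y - x))) sums F y))"

definition deriv1 :: "(nat \<Rightarrow> 'a \<Rightarrow> 'a list \<Rightarrow> 'b) \<Rightarrow> 'a \<Rightarrow> 'a \<Rightarrow> 'b" where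
  "deriv1 D x = (\<lambda>h. D 1 x [h])"

definition smale_gamma :: "(nat \<Rightarrow> 'a::real_normed_vector \<Rightarrow> 'a list \<Rightarrow> 'b::real_normed_vector) \<Rightarrow> 'a \<Rightarrow> real" where
  "smale_gamma D x0 =
     (SUP n \<in> {2..}. (mnorm n (\<lambda>hs. inv (deriv1 D x0) (D n x0 hs)) / fact n) powr (1 / (real n - 1)))"

definition inexact_newton_step ::
  "('a \<Rightarrow> 'b::real_normed_vector) \<Rightarrow> ('a \<Rightarrow> 'a \<Rightarrow> 'b) \<Rightarrow> ('b \<Rightarrow> 'c::real_normed_vector) \<Rightarrow> real \<Rightarrow> 'a \<Rightarrow> 'a \<Rightarrow> bool" where
  "inexact_newton_step F F' Linv \<theta> x s \<longleftrightarrow>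
     norm (Linv (F x + F' x s)) \<le> \<theta> * norm (Linv (F x))"

definition majorant_f :: "real \<Rightarrow> real \<Rightarrow> real \<Rightarrow> real" where
  "majorant_f \<gamma> b t = t / (1 - \<gamma> * t) - 2 * t + b"

definition left_deriv :: "(real \<Rightarrow> real) \<Rightarrow> real \<Rightarrow> real" where
  "left_deriv g t = Lim (at_left t) (\<lambda>s. (g t - g s) / (t - s))"

end

theory Submission
  imports Defs
begin

text \<open>
  Put \<open>G = F'(x0)^-1 F\<close>. Along every line through \<open>x0\<close> the map \<open>G\<close> is locally a power series, and so is its
  Taylor series at \<open>x0\<close>; by the identity theorem the two agree on the whole ball of radius \<open>1 / \<gamma>\<close>.
  Expanding the (not necessarily symmetric) multilinear terms around \<open>x0 + v\<close> and summing geometric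
  series then bounds \<open>G'(x) - I\<close> and the first-order Taylor remainder of \<open>G\<close> by the corresponding
  quantities of the scalar majorant \<open>f\<close>, without any use of second derivatives.

  For the inexact Newton method one tracks pairs \<open>(t, e)\<close> with \<open>norm (x - x0) \<le> t\<close> and
  \<open>norm (G x) \<le> f t + e\<close>. One step moves \<open>t\<close> to \<open>t + (1 + \<theta>) (f t + e) / |f' t|\<close> and \<open>e\<close> to
  \<open>e + 2 \<theta> (f t + e)\<close>. The region \<open>0 \<le> t < lam\<close>, \<open>0 \<le> e \<le> \<kappa> t\<close> is invariant because the line
  \<open>- \<kappa> t\<close> is tangent to the graph of \<open>f\<close> at \<open>lam\<close>, and convexity of \<open>f'\<close> contracts \<open>f t + e\<close>
  by \<open>(1 + \<theta>\<^sup>2) / 2\<close>.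
\<close>

section \<open>The bounded inverse theorem\<close>

text \<open>Nonsingularity is given as mere bijectivity of \<open>deriv1 D x0\<close>, so continuity
  of the inverse has to be derived by a Baire argument. Continuity bounds the set under the supremum
  in \<open>smale_gamma\<close>, which makes \<gamma> a true bound on the Taylor coefficients at
  \<open>x0\<close>, and it lets the inverse pass through series.

  Analyticity supplies expansions with unknown local radii, whereas \<gamma> speaks only of the
  coefficients at \<open>x0\<close>. Hence the need to show that the series at \<open>x0\<close>
  represents \<open>G\<close> on the whole ball.

  With a tolerance, the linear model keeps up to \<theta> times the old residual, so comparison with
  the plain Newton sequence of \<open>f\<close> fails. Raising \<open>f\<close> by \<open>e\<close>
  leaves its slope unchanged and absorbs this leftover. The constant \<kappa> is the maximum of
  \<open>- f t / t\<close>, attained at \<open>lam\<close>; it is positive exactly when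
  \<open>b * \<gamma> < 3 - 2 * sqrt 2\<close>. The bound on \<theta> reads
  \<open>2 * \<theta> / (1 + \<theta>) \<le> \<kappa>\<close>, and the left side bounds the growth
  of \<open>e\<close> relative to that of \<open>t\<close>, since slopes on \<open>[0, lam]\<close>
  are at most 1.\<close>

lemma approx_surj_imp_bounded_preimage:
  fixes f :: "'a::banach \<Rightarrow> 'b::real_normed_vector"
  assumes f: "bounded_linear f" and "0 \<le> K"
    and approx: "\<And>y. \<exists>x. norm x \<le> K * norm y \<and> norm (y - f x) \<le> norm y / 2"
  shows "\<exists>x. f x = y \<and> norm x \<le> 2 * K * norm y"
proof -
  interpret f: bounded_linear f by (rule f)
  obtain p where p: "\<And>y. norm (p y) \<le> K * norm y" "\<And>y. norm (y - f (p y)) \<le> norm y / 2"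
    using approx by metis
  \<comment> \<open>\<open>r k\<close> is the part of \<open>y\<close> still missed after
    \<open>k\<close> corrections. Each correction halves it, so the corrections form an absolutely
    convergent series whose sum is an exact preimage.\<close>
  define r where "r \<equiv> rec_nat y (\<lambda>_ z. z - f (p z))"
  have r_Suc: "r (Suc k) = r k - f (p (r k))" and r_0: "r 0 = y" for k
    by (simp_all add: r_def)
  have r_le: "norm (r k) \<le> norm y * (1 / 2) ^ k" for k
  proof (induction k)
    case (Suc k)
    then show ?case using p(2)[of "r k"] by (simp add: r_Suc)
  qed (simp add: r_0)
  have geo: "(\<lambda>k. K * norm y * (1 / 2) ^ k) sums (2 * K * norm y)"
    using sums_mult[OF geometric_sums[of "1 / 2 :: real"], of "K * norm y"] by (simp add: mult_ac)
  have p_le: "norm (p (r k)) \<le> K * norm y * (1 / 2) ^ k" for k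
    using p(1)[of "r k"] mult_left_mono[OF r_le \<open>0 \<le> K\<close>, of k] by (simp add: mult_ac)
  have norm_summable: "summable (\<lambda>k. norm (p (r k)))"
    by (rule summable_comparison_test[OF _ sums_summable[OF geo]]) (use p_le in auto)
  have "(\<lambda>k. norm y * (1 / 2) ^ k) \<longlonglongrightarrow> norm y * 0"
    by (intro tendsto_intros) auto
  then have "(\<lambda>k. norm y * (1 / 2) ^ k) \<longlonglongrightarrow> 0"
    by simp
  with always_eventually[OF allI[OF r_le]] have "r \<longlonglongrightarrow> 0"
    by (rule Lim_null_comparison)
  then have "(\<lambda>k. r k - r (Suc k)) sums (r 0 - 0)"
    by (rule telescope_sums')
  then have "(\<lambda>k. f (p (r k))) sums y"
    by (simp add: r_Suc r_0)
  moreover have "(\<lambda>k. f (p (r k))) sums f (\<Sum>k. p (r k))"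
    by (rule f.sums[OF summable_sums[OF summable_norm_cancel[OF norm_summable]]])
  ultimately have "f (\<Sum>k. p (r k)) = y"
    by (rule sums_unique2[symmetric])
  moreover have "norm (\<Sum>k. p (r k)) \<le> 2 * K * norm y"
    using order_trans[OF summable_norm[OF norm_summable]
        suminf_le[OF p_le norm_summable sums_summable[OF geo]]]
    unfolding sums_unique[OF geo, symmetric] .
  ultimately show ?thesis by blast
qed

text \<open>The images of the balls of integer radius cover the complete space, so their closures
  cannot all have empty interior.\<close>

lemma Baire_surj_closure_ball:
  fixes f :: "'a::real_normed_vector \<Rightarrow> 'b::banach"
  assumes "surj f"
  shows "\<exists>n::nat. interior (closure (f ` ball 0 (real n))) \<noteq> {}"
proof (rule ccontr)
  let ?S = "\<lambda>n::nat. closure (f ` ball 0 (real n))"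
  assume "\<not> ?thesis"
  then have "Met_TC.mtopology interior_of \<Union>(range ?S) = {}"
    by (intro Met_TC.metric_Baire_category_alt)
      (auto simp: mcomplete_iff_complete complete_UNIV)
  moreover have "y \<in> \<Union>(range ?S)" for y
  proof -
    obtain x where x: "y = f x" using assms by blast
    obtain n where "norm x < real n" using reals_Archimedean2 by blast
    then have "y \<in> f ` ball 0 (real n)" using x by auto
    then have "y \<in> ?S n" using closure_subset by (rule rev_subsetD)
    then show ?thesis by blast
  qed
  ultimately have "interior (UNIV :: 'b set) = {}"
    by (metis UNIV_eq_I mtopology_is_euclidean euclidean_interior_of)
  then show False by simp
qed

lemma bounded_linear_inv:
  fixes f :: "'a::banach \<Rightarrow> 'b::banach"
  assumes f: "bounded_linear f" and "bij f"
  shows "bounded_linear (inv f)"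
proof -
  interpret f: bounded_linear f by (rule f)
  have surj: "surj f" and inj: "inj f" using \<open>bij f\<close> by (auto simp: bij_def)
  obtain n y0 e where e: "0 < e" and ball: "ball y0 e \<subseteq> closure (f ` ball 0 (real n))"
    using Baire_surj_closure_ball[OF surj] by (metis ex_in_conv mem_interior)
  \<comment> \<open>Writing \<open>y = (y0 + y) - y0\<close> moves the ball from \<open>y0\<close>
    to the origin: approximate preimages of both points are subtracted, and their two errors
    \<open>e / 8\<close> add up to \<open>e / 4\<close>.\<close>
  have near: "\<exists>x. norm x \<le> 2 * real n \<and> norm (y - f x) \<le> e / 4" if "norm y < e" for y
  proof -
    have "y0 + y \<in> closure (f ` ball 0 (real n))" "y0 \<in> closure (f ` ball 0 (real n))"
      using ball that e by (auto simp: dist_norm subset_iff)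
    moreover have "0 < e / 8" using e by simp
    ultimately have "\<exists>z\<in>f ` ball 0 (real n). dist z (y0 + y) < e / 8"
      "\<exists>z\<in>f ` ball 0 (real n). dist z y0 < e / 8"
      unfolding closure_approachable by blast+
    then obtain a c where a: "norm a < real n" "dist (f a) (y0 + y) < e / 8"
      and c: "norm c < real n" "dist (f c) y0 < e / 8"
      by auto
    have "y - f (a - c) = (f c - y0) - (f a - (y0 + y))"
      by (simp add: f.diff)
    then have "norm (y - f (a - c)) \<le> norm (f c - y0) + norm (f a - (y0 + y))"
      by (metis norm_triangle_ineq4)
    moreover have "norm (a - c) \<le> 2 * real n"
      using norm_triangle_ineq4[of a c] a c by simp
    ultimately show ?thesis using a c unfolding dist_norm by (intro exI[of _ "a - c"]) auto
  qed
  define K where "K = 4 * real n / e"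
  have approx: "\<exists>x. norm x \<le> K * norm y \<and> norm (y - f x) \<le> norm y / 2" for y
  proof (cases "y = 0")
    case True
    then show ?thesis by (intro exI[of _ 0]) (simp add: f.zero)
  next
    case False
    \<comment> \<open>Scales \<open>y\<close> to norm \<open>e / 2\<close>, so that the absolute
      error \<open>e / 4\<close> becomes half of the norm.\<close>
    define c where "c = e / (2 * norm y)"
    have c: "0 < c" "c * norm y = e / 2" using e False by (auto simp: c_def)
    have "norm (c *\<^sub>R y) < e" using c e by simp
    then obtain x where x: "norm x \<le> 2 * real n" "norm (c *\<^sub>R y - f x) \<le> e / 4"
      using near by blast
    have "c *\<^sub>R y - f x = c *\<^sub>R (y - f (inverse c *\<^sub>R x))"
      using c by (simp add: f.scaleR scaleR_diff_right)
    then have "c * norm (y - f (inverse c *\<^sub>R x)) = norm (c *\<^sub>R y - f x)"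
      using c by simp
    also have "\<dots> \<le> c * (norm y / 2)"
      using x(2) c(2) by linarith
    finally have "norm (y - f (inverse c *\<^sub>R x)) \<le> norm y / 2"
      using c(1) by (simp only: mult_le_cancel_left_pos)
    moreover have "norm (inverse c *\<^sub>R x) \<le> K * norm y"
      using x c e mult_left_mono[OF x(1), of "2 * norm y / e"] by (simp add: K_def c_def field_simps)
    ultimately show ?thesis by blast
  qed
  show ?thesis
  proof (rule bounded_linear_intro[where K = "2 * K"])
    fix x y :: 'b and c :: real
    show "inv f (x + y) = inv f x + inv f y"
      by (rule inv_f_eq[OF inj]) (simp add: f.add surj_f_inv_f[OF surj])
    show "inv f (c *\<^sub>R x) = c *\<^sub>R inv f x"
      by (rule inv_f_eq[OF inj]) (simp add: f.scaleR surj_f_inv_f[OF surj])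
    show "norm (inv f x) \<le> norm x * (2 * K)"
      using approx_surj_imp_bounded_preimage[OF f _ approx, of x] e
      by (auto simp: K_def inv_f_f[OF inj] mult_ac)
  qed
qed

section \<open>Multilinear maps on the diagonal\<close>

lemma multilinear_Cons:
  assumes "multilinear (Suc n) M"
  shows "multilinear n (\<lambda>hs. M (a # hs))"
  unfolding multilinear_def
proof (intro allI impI)
  fix xs ys :: "'a list" assume "length xs + length ys + 1 = n"
  then have "linear (\<lambda>h. M ((a # xs) @ h # ys))"
    using assms unfolding multilinear_def by (metis Suc_eq_plus1 add_Suc length_Cons)
  then show "linear (\<lambda>h. M (a # xs @ h # ys))" by simp
qed

lemma multilinear_linear_head:
  assumes "multilinear (Suc n) M" "length hs = n"
  shows "linear (\<lambda>h. M (h # hs))"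
proof -
  have "linear (\<lambda>h. M ([] @ h # hs))"
    using assms unfolding multilinear_def by (metis Suc_eq_plus1 add_0 list.size(3))
  then show ?thesis by simp
qed

lemma multilinear_compose_linear:
  assumes "multilinear n M" "linear f"
  shows "multilinear n (\<lambda>hs. f (M hs))"
  using assms linear_compose[of _ f] unfolding multilinear_def comp_def by blast

text \<open>The factor may depend on the entry: \<open>1 / norm h\<close> normalises a whole list at
  once, and a constant factor gives homogeneity of degree \<open>n\<close>.\<close>

lemma multilinear_scaleR:
  assumes "multilinear n M" "length hs = n"
  shows "M (map (\<lambda>h. c h *\<^sub>R h) hs) = prod_list (map c hs) *\<^sub>R M hs"
  using assms
proof (induction hs arbitrary: n M)
  case (Cons a hs)
  then have n: "n = Suc (length hs)" by simp
  have "M (map (\<lambda>h. c h *\<^sub>R h) (a # hs)) = prod_list (map c hs) *\<^sub>R M ((c a *\<^sub>R a) # hs)"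
    using Cons.IH[OF multilinear_Cons] Cons.prems n by simp
  also have "\<dots> = prod_list (map c (a # hs)) *\<^sub>R M (a # hs)"
    using linear_cmul[OF multilinear_linear_head, of "length hs" M hs "c a" a] Cons.prems n
    by (simp add: mult.commute)
  finally show ?case .
qed simp

text \<open>Entries are normalised to unit length, and a list with a zero entry is treated apart.
  The supremum in \<open>mnorm\<close> bounds the values only once its set is known to be bounded
  above.\<close>

lemma bounded_multilinear_norm_le:
  assumes "bounded_multilinear n M" and hs: "length hs = n"
  shows "norm (M hs) \<le> mnorm n M * prod_list (map norm hs)"
proof -
  obtain K where mult: "multilinear n M"
    and K: "\<And>hs. length hs = n \<Longrightarrow> norm (M hs) \<le> K * prod_list (map norm hs)"
    using assms unfolding bounded_multilinear_def by blast
  define B where "B = {hs :: 'a list. length hs = n \<and> (\<forall>h\<in>set hs. norm h \<le> 1)}"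
  have prod_nonneg: "0 \<le> prod_list (map norm (hs :: 'a list))" for hs
    by (induction hs) auto
  have prod_le_1: "prod_list (map norm hs) \<le> 1" if "\<forall>h\<in>set hs. norm h \<le> 1" for hs :: "'a list"
    using that prod_nonneg by (induction hs) (auto intro: mult_le_one)
  have bdd: "bdd_above ((\<lambda>hs. norm (M hs)) ` B)"
  proof (rule bdd_aboveI2)
    fix hs assume "hs \<in> B"
    then have hs: "length hs = n" "prod_list (map norm hs) \<le> 1" using prod_le_1 by (auto simp: B_def)
    have "K * prod_list (map norm hs) \<le> \<bar>K\<bar> * prod_list (map norm hs)"
      using prod_nonneg by (intro mult_right_mono) auto
    also have "\<dots> \<le> \<bar>K\<bar> * 1" using hs by (intro mult_left_mono) auto
    finally show "norm (M hs) \<le> \<bar>K\<bar>" using K[OF hs(1)] by simp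
  qed
  define u where "u = (\<lambda>h::'a. (1 / norm h) *\<^sub>R h)"
  have eq: "M hs = prod_list (map norm hs) *\<^sub>R M (map u hs)"
  proof (cases "0 \<in> set hs")
    case True
    then have "prod_list (map norm hs) = 0" by (auto simp: prod_list_zero_iff)
    then show ?thesis using K[OF hs] by simp
  next
    case False
    then have "prod_list (map norm hs) * prod_list (map (\<lambda>h. 1 / norm h) hs) = 1"
      by (induction hs) auto
    then show ?thesis
      using multilinear_scaleR[OF mult hs, of "\<lambda>h. 1 / norm h"] by (simp add: u_def)
  qed
  have "map u hs \<in> B" using hs by (auto simp: B_def u_def)
  then have le: "norm (M (map u hs)) \<le> mnorm n M"
    unfolding mnorm_def B_def[symmetric] by (rule cSUP_upper[OF _ bdd])
  have "prod_list (map norm hs) * norm (M (map u hs)) \<le> mnorm n M * prod_list (map norm hs)"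
    using mult_left_mono[OF le prod_nonneg[of hs]] by (simp add: mult.commute)
  then show ?thesis
    using prod_nonneg[of hs] by (subst eq) simp
qed

lemma mnorm_least:
  assumes "\<And>hs. length hs = n \<Longrightarrow> \<forall>h\<in>set hs. norm h \<le> 1 \<Longrightarrow> norm (M hs) \<le> c"
  shows "mnorm n (M :: 'a::real_normed_vector list \<Rightarrow> 'b::real_normed_vector) \<le> c"
  unfolding mnorm_def
proof (rule cSUP_least)
  show "{hs :: 'a list. length hs = n \<and> (\<forall>h\<in>set hs. norm h \<le> 1)} \<noteq> {}"
    by (auto intro!: exI[of _ "replicate n 0"])
qed (use assms in auto)

text \<open>A negative value would force \<open>M\<close> to vanish on all lists of length
  \<open>n\<close>, and then the supremum is 0.\<close>

lemma mnorm_nonneg: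
  assumes "bounded_multilinear n (M :: 'a::real_normed_vector list \<Rightarrow> 'b::real_normed_vector)"
  shows "0 \<le> mnorm n M"
proof (rule ccontr)
  assume neg: "\<not> 0 \<le> mnorm n M"
  have "norm (M hs) \<le> 0" if "length hs = n" for hs
  proof -
    have "0 \<le> prod_list (map norm hs)" by (induction hs) auto
    then show ?thesis
      using bounded_multilinear_norm_le[OF assms that] neg
      by (meson linorder_not_le mult_nonpos_nonneg order_trans less_imp_le)
  qed
  then have "norm (M hs) = 0" if "length hs = n" for hs using that by simp
  then have "mnorm n M = (SUP hs \<in> {hs :: 'a list. length hs = n \<and> (\<forall>h\<in>set hs. norm h \<le> 1)}. 0)"
    unfolding mnorm_def by (intro SUP_cong) auto
  also have "\<dots> = 0"
    by (rule cSUP_const) (auto intro!: exI[of _ "replicate n 0"])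
  finally show False using neg by simp
qed

text \<open>For a multilinear \<open>M\<close> that need not be symmetric, this is the derivative of
  \<open>w \<mapsto> M [w, \<dots>, w]\<close> at \<open>v\<close> in direction \<open>h\<close>.\<close>
fun diag_deriv :: "nat \<Rightarrow> ('a list \<Rightarrow> 'b::real_vector) \<Rightarrow> 'a \<Rightarrow> 'a \<Rightarrow> 'b" where
  "diag_deriv 0 M v h = 0"
| "diag_deriv (Suc n) M v h = M (h # replicate n v) + diag_deriv n (\<lambda>hs. M (v # hs)) v h"

lemma diag_deriv_scaleR:
  "multilinear n M \<Longrightarrow> diag_deriv n M v (c *\<^sub>R h) = c *\<^sub>R diag_deriv n M v h"
proof (induction n arbitrary: M)
  case (Suc n)
  show ?case
    using linear_cmul[OF multilinear_linear_head[OF Suc.prems], of "replicate n v"]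
    by (simp add: scaleR_add_right Suc.IH[OF multilinear_Cons[OF Suc.prems]])
qed simp

context
  fixes v h :: "'a::real_normed_vector" and t d :: real
  assumes v: "norm v \<le> t" and h: "norm h \<le> d"
begin

lemma t_nonneg: "0 \<le> t" and d_nonneg: "0 \<le> d"
  using order_trans[OF norm_ge_zero v] order_trans[OF norm_ge_zero h] by auto

text \<open>Fixing the first slot costs a factor \<open>s\<close> in the constant; this is how the
  constant \<open>K\<close> travels through the inductions on the arity below.\<close>

lemma multilinear_bound_Cons:
  fixes M :: "'a list \<Rightarrow> 'b::real_normed_vector"
  assumes "\<And>hs. length hs = Suc n \<Longrightarrow> norm (M hs) \<le> K * prod_list (map norm hs)"
    and "0 \<le> K" "norm a \<le> s" "length hs = n"
  shows "norm (M (a # hs)) \<le> (K * s) * prod_list (map norm hs)"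
proof -
  have "0 \<le> prod_list (map norm hs)" by (induction hs) auto
  then have "norm a * (K * prod_list (map norm hs)) \<le> s * (K * prod_list (map norm hs))"
    using assms by (intro mult_right_mono) auto
  then show ?thesis using assms(1)[of "a # hs"] assms(4) by (simp add: mult_ac)
qed

lemma norm_multilinear_diag_le:
  fixes M :: "'a list \<Rightarrow> 'b::real_normed_vector"
  assumes "norm w \<le> s" "0 \<le> K"
    and "\<And>hs. length hs = n \<Longrightarrow> norm (M hs) \<le> K * prod_list (map norm hs)"
  shows "norm (M (replicate n w)) \<le> K * s ^ n"
proof -
  have "norm (M (replicate n w)) \<le> K * norm w ^ n"
    using assms(3)[of "replicate n w"] by (simp add: prod_list_replicate)
  also have "\<dots> \<le> K * s ^ n" using assms by (intro mult_left_mono power_mono) auto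
  finally show ?thesis .
qed

lemma norm_diag_deriv_le:
  fixes M :: "'a list \<Rightarrow> 'b::real_normed_vector"
  assumes "0 \<le> K" "\<And>hs. length hs = n \<Longrightarrow> norm (M hs) \<le> K * prod_list (map norm hs)"
  shows "norm (diag_deriv n M v h) \<le> K * (real n * t ^ (n - 1) * d)"
  using assms
proof (induction n arbitrary: M K)
  case (Suc n)
  have "norm (diag_deriv n (\<lambda>hs. M (v # hs)) v h) \<le> (K * t) * (real n * t ^ (n - 1) * d)"
    using Suc.prems t_nonneg by (intro Suc.IH multilinear_bound_Cons v) auto
  moreover have "norm (M (h # replicate n v)) \<le> (K * d) * t ^ n"
    using Suc.prems d_nonneg
    by (intro norm_multilinear_diag_le[where M = "\<lambda>hs. M (h # hs)"] multilinear_bound_Cons v h) auto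
  \<comment> \<open>For \<open>n = 0\<close> the factor \<open>real n\<close> vanishes, so the
    truncated exponent \<open>n - 1\<close> does no harm.\<close>
  moreover have "(K * t) * (real n * t ^ (n - 1) * d) = K * (real n * t ^ n * d)"
    by (cases n) auto
  ultimately have "norm (diag_deriv (Suc n) M v h) \<le> (K * d) * t ^ n + K * (real n * t ^ n * d)"
    unfolding diag_deriv.simps by (metis norm_triangle_mono)
  then show ?case by (simp add: algebra_simps)
qed simp

text \<open>The monomial \<open>K * x ^ n\<close> acts as scalar majorant. Replacing the head
  \<open>v + h\<close> by \<open>v\<close> costs one term with head \<open>h\<close>; the rest is
  the same difference for arity one less.\<close>

lemma norm_multilinear_diag_diff_le:
  fixes M :: "'a list \<Rightarrow> 'b::real_normed_vector"
  assumes "multilinear n M" "0 \<le> K"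
    "\<And>hs. length hs = n \<Longrightarrow> norm (M hs) \<le> K * prod_list (map norm hs)"
  shows "norm (M (replicate n (v + h)) - M (replicate n v)) \<le> K * ((t + d) ^ n - t ^ n)"
  using assms
proof (induction n arbitrary: M K)
  case (Suc n)
  let ?Mv = "\<lambda>hs. M (v # hs)"
  have "norm (?Mv (replicate n (v + h)) - ?Mv (replicate n v)) \<le> (K * t) * ((t + d) ^ n - t ^ n)"
    using Suc.prems t_nonneg by (intro Suc.IH multilinear_bound_Cons v multilinear_Cons) auto
  moreover have "norm (M (h # replicate n (v + h))) \<le> (K * d) * (t + d) ^ n"
    using Suc.prems d_nonneg norm_triangle_mono[OF v h]
    by (intro norm_multilinear_diag_le[where M = "\<lambda>hs. M (h # hs)"] multilinear_bound_Cons h) auto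
  moreover have "M (replicate (Suc n) (v + h)) - M (replicate (Suc n) v)
      = (?Mv (replicate n (v + h)) - ?Mv (replicate n v)) + M (h # replicate n (v + h))"
    using linear_add[OF multilinear_linear_head[OF Suc.prems(1)], of "replicate n (v + h)" v h]
    by simp
  ultimately have "norm (M (replicate (Suc n) (v + h)) - M (replicate (Suc n) v))
      \<le> (K * t) * ((t + d) ^ n - t ^ n) + (K * d) * (t + d) ^ n"
    by (metis norm_triangle_mono)
  then show ?case by (simp add: algebra_simps)
qed simp

lemma norm_multilinear_diag_remainder_le:
  fixes M :: "'a list \<Rightarrow> 'b::real_normed_vector"
  assumes "multilinear n M" "0 \<le> K"
    "\<And>hs. length hs = n \<Longrightarrow> norm (M hs) \<le> K * prod_list (map norm hs)"
  shows "norm (M (replicate n (v + h)) - M (replicate n v) - diag_deriv n M v h)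
    \<le> K * ((t + d) ^ n - t ^ n - real n * t ^ (n - 1) * d)"
  using assms
proof (induction n arbitrary: M K)
  case (Suc n)
  let ?Mv = "\<lambda>hs. M (v # hs)" and ?Mh = "\<lambda>hs. M (h # hs)"
  have "norm (?Mv (replicate n (v + h)) - ?Mv (replicate n v) - diag_deriv n ?Mv v h)
      \<le> (K * t) * ((t + d) ^ n - t ^ n - real n * t ^ (n - 1) * d)"
    using Suc.prems t_nonneg by (intro Suc.IH multilinear_bound_Cons v multilinear_Cons) auto
  moreover have "(K * t) * ((t + d) ^ n - t ^ n - real n * t ^ (n - 1) * d)
      = (K * t) * ((t + d) ^ n - t ^ n) - K * real n * t ^ n * d"
    by (cases n) (auto simp: algebra_simps)
  moreover have "norm (?Mh (replicate n (v + h)) - ?Mh (replicate n v)) \<le> (K * d) * ((t + d) ^ n - t ^ n)"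
    using Suc.prems d_nonneg
    by (intro norm_multilinear_diag_diff_le multilinear_bound_Cons h multilinear_Cons) auto
  \<comment> \<open>The head \<open>v\<close> leaves a remainder of lower arity. The head
    \<open>h\<close> leaves only a zeroth-order difference, because \<open>diag_deriv\<close> has
    already taken \<open>M (h # replicate n v)\<close>.\<close>
  moreover have "M (replicate (Suc n) (v + h)) - M (replicate (Suc n) v) - diag_deriv (Suc n) M v h
      = (?Mv (replicate n (v + h)) - ?Mv (replicate n v) - diag_deriv n ?Mv v h)
        + (?Mh (replicate n (v + h)) - ?Mh (replicate n v))"
    using linear_add[OF multilinear_linear_head[OF Suc.prems(1)], of "replicate n (v + h)" v h]
    by simp
  ultimately have "norm (M (replicate (Suc n) (v + h)) - M (replicate (Suc n) v) - diag_deriv (Suc n) M v h)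
      \<le> ((K * t) * ((t + d) ^ n - t ^ n) - K * real n * t ^ n * d) + (K * d) * ((t + d) ^ n - t ^ n)"
    by (metis norm_triangle_mono)
  then show ?case by (simp add: algebra_simps)
qed simp

end

section \<open>Power series of a real variable with values in a Banach space\<close>

text \<open>Unless all coefficients vanish, the first nonzero term dominates the rest of the series
  near 0.\<close>

lemma powser_isolated_zero:
  fixes c :: "nat \<Rightarrow> 'b::banach" and f :: "real \<Rightarrow> 'b"
  assumes "0 < \<delta>" and f: "\<And>u. \<bar>u\<bar> < \<delta> \<Longrightarrow> (\<lambda>n. u ^ n *\<^sub>R c n) sums f u"
  shows "(\<forall>u. \<bar>u\<bar> < \<delta> \<longrightarrow> f u = 0) \<or> (\<exists>e>0. \<forall>u. 0 < \<bar>u\<bar> \<and> \<bar>u\<bar> < e \<longrightarrow> f u \<noteq> 0)"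
proof (cases "\<forall>n. c n = 0")
  case True
  then show ?thesis using f sums_unique2[OF sums_zero] by fastforce
next
  case False
  define m where "m = (LEAST n. c n \<noteq> 0)"
  have m: "c m \<noteq> 0" using False LeastI_ex[of "\<lambda>n. c n \<noteq> 0"] by (auto simp: m_def)
  have less_m: "c n = 0" if "n < m" for n using that not_less_Least m_def by blast
  define r where "r = \<delta> / 2"
  have r: "0 < r" "\<bar>r\<bar> < \<delta>" using \<open>0 < \<delta>\<close> by (auto simp: r_def)
  have "Bseq (\<lambda>n. r ^ n *\<^sub>R c n)"
    by (rule convergent_imp_Bseq[OF convergentI[OF summable_LIMSEQ_zero[OF sums_summable[OF f[OF r(2)]]]]])
  then obtain K where "0 < K" and K': "\<forall>n. norm (r ^ n *\<^sub>R c n) \<le> K"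
    by (rule BseqE)
  note K = spec[OF K']
  \<comment> \<open>For \<open>\<bar>u\<bar> \<le> r / 2\<close> the terms beyond index
    \<open>m\<close> are dominated by a geometric series of ratio \<open>1 / 2\<close>, with total
    \<open>\<bar>u\<bar> ^ Suc m * B\<close>. The choice of \<open>e\<close> keeps this below the
    term of index \<open>m\<close>.\<close>
  define B where "B = 2 * K / r ^ Suc m"
  have "0 < B" using \<open>0 < K\<close> r by (simp add: B_def)
  define e where "e = min (r / 2) (norm (c m) / B)"
  have "0 < e" using r m \<open>0 < B\<close> by (simp add: e_def)
  moreover have "f u \<noteq> 0" if u: "0 < \<bar>u\<bar>" "\<bar>u\<bar> < e" for u
  proof
    assume "f u = 0"
    have u': "\<bar>u\<bar> \<le> r / 2" "\<bar>u\<bar> * B < norm (c m)"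
      using u \<open>0 < B\<close> by (auto simp: e_def field_simps)
    have "(\<lambda>n. u ^ n *\<^sub>R c n) sums 0" using f[of u] u' r \<open>f u = 0\<close> by simp
    then have "(\<lambda>n. u ^ (n + Suc m) *\<^sub>R c (n + Suc m)) sums (0 - (\<Sum>n<Suc m. u ^ n *\<^sub>R c n))"
      by (rule sums_split_initial_segment)
    moreover have "(\<Sum>n<Suc m. u ^ n *\<^sub>R c n) = u ^ m *\<^sub>R c m" using less_m by simp
    ultimately have tail: "(\<lambda>n. u ^ (n + Suc m) *\<^sub>R c (n + Suc m)) sums (- (u ^ m *\<^sub>R c m))" by simp
    have le: "norm (u ^ (n + Suc m) *\<^sub>R c (n + Suc m)) \<le> \<bar>u\<bar> ^ Suc m * (K / r ^ Suc m) * (1 / 2) ^ n" for n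
    proof -
      have "\<bar>u\<bar> ^ n * norm (c (n + Suc m)) \<le> (r / 2) ^ n * (K / r ^ (n + Suc m))"
        using u' K[of "n + Suc m"] r
        by (intro mult_mono power_mono) (auto simp: pos_le_divide_eq mult.commute)
      also have "\<dots> = (K / r ^ Suc m) * (1 / 2) ^ n"
        using r by (simp add: power_add power_divide field_simps)
      finally have "\<bar>u\<bar> ^ Suc m * (\<bar>u\<bar> ^ n * norm (c (n + Suc m)))
          \<le> \<bar>u\<bar> ^ Suc m * ((K / r ^ Suc m) * (1 / 2) ^ n)"
        by (rule mult_left_mono) simp
      then show ?thesis by (simp add: power_add power_abs abs_mult mult_ac)
    qed
    have geo: "(\<lambda>n. \<bar>u\<bar> ^ Suc m * (K / r ^ Suc m) * (1 / 2) ^ n) sums (\<bar>u\<bar> ^ Suc m * B)"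
      using sums_mult[OF geometric_sums[of "1 / 2 :: real"], of "\<bar>u\<bar> ^ Suc m * (K / r ^ Suc m)"]
      by (simp add: B_def mult_ac)
    have "norm (- (u ^ m *\<^sub>R c m)) \<le> \<bar>u\<bar> ^ Suc m * B"
      by (rule norm_sums_le[OF tail geo le])
    then have "\<bar>u\<bar> ^ m * norm (c m) \<le> \<bar>u\<bar> ^ m * (\<bar>u\<bar> * B)" by (simp add: power_abs mult_ac)
    then show False using u u' by (simp add: mult_le_cancel_left)
  qed
  ultimately show ?thesis by blast
qed

text \<open>Binomial expansion of \<open>(s + u) ^ n\<close> followed by exchanging the two
  summations. The absolute double sum is the original series at
  \<open>\<bar>s\<bar> + \<bar>u\<bar>\<close>, hence the restriction on \<open>u\<close>.\<close>

lemma powser_recenter: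
  fixes a :: "nat \<Rightarrow> 'b::banach"
  assumes a: "summable (\<lambda>n. \<rho> ^ n * norm (a n))" and "\<bar>s\<bar> < \<rho>"
  shows "\<exists>c. \<forall>u. \<bar>s\<bar> + \<bar>u\<bar> \<le> \<rho> \<longrightarrow> (\<lambda>k. u ^ k *\<^sub>R c k) sums (\<Sum>n. (s + u) ^ n *\<^sub>R a n)"
proof -
  \<comment> \<open>The contribution of term \<open>n\<close> to the coefficient of
    \<open>u ^ k\<close>. For \<open>k > n\<close> the binomial coefficient is 0, so the truncated
    \<open>n - k\<close> is harmless.\<close>
  define b where "b = (\<lambda>k n. (real (n choose k) * s ^ (n - k)) *\<^sub>R a n)"
  have binom: "(\<Sum>k\<le>n. real (n choose k) * x ^ (n - k) * y ^ k) = (x + y) ^ n" for x y :: real and n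
    using binomial_ring[of y x n] by (simp add: mult_ac add.commute)
  have bound: "norm (u ^ k *\<^sub>R b k n) = (real (n choose k) * \<bar>s\<bar> ^ (n - k) * \<bar>u\<bar> ^ k) * norm (a n)" for u k n
    by (simp add: b_def abs_mult power_abs)
  have summ: "(\<lambda>n. x ^ n * norm (a n)) summable_on UNIV" "summable (\<lambda>n. x ^ n * norm (a n))"
    if "0 \<le> x" "x \<le> \<rho>" for x
  proof -
    have "norm (x ^ n * norm (a n)) \<le> \<rho> ^ n * norm (a n)" for n
      using that by (simp add: abs_mult mult_right_mono power_mono)
    then show "summable (\<lambda>n. x ^ n * norm (a n))"
      by (intro summable_comparison_test[OF _ a]) blast
    then show "(\<lambda>n. x ^ n * norm (a n)) summable_on UNIV"
      using that by (intro summable_nonneg_imp_summable_on) auto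
  qed
  have pairs: "(\<lambda>(n, k). u ^ k *\<^sub>R b k n) summable_on (UNIV \<times> UNIV)" if u: "\<bar>s\<bar> + \<bar>u\<bar> \<le> \<rho>" for u
  proof -
    have "((\<lambda>k. norm (u ^ k *\<^sub>R b k n)) has_sum (\<bar>s\<bar> + \<bar>u\<bar>) ^ n * norm (a n)) UNIV" for n
      unfolding bound
      by (rule has_sum_finite_neutralI[of "{..n}"])
        (auto simp: binom sum_distrib_right[symmetric] binomial_eq_0)
    then have "(\<lambda>(n, k). norm (u ^ k *\<^sub>R b k n)) summable_on (UNIV \<times> UNIV)"
      using u by (intro summable_on_SigmaI[OF _ summ(1)]) auto
    then show ?thesis
      by (rule abs_summable_summable[OF back_subst[of "\<lambda>f. f summable_on UNIV \<times> UNIV"]])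
        (simp add: case_prod_unfold)
  qed
  \<comment> \<open>The largest admissible \<open>\<bar>u\<bar>\<close>. One term of the binomial
    sum is at most the whole sum \<open>\<rho> ^ n\<close>, so dividing by \<open>u0 ^ k\<close>
    bounds \<open>b k n\<close>, also when \<open>u\<close> itself is 0.\<close>
  define u0 where "u0 = \<rho> - \<bar>s\<bar>"
  have u0: "0 < u0" "\<bar>s\<bar> + u0 = \<rho>" using \<open>\<bar>s\<bar> < \<rho>\<close> by (auto simp: u0_def)
  have b_summable: "b k summable_on UNIV" for k
  proof (rule norm_summable_imp_summable_on, rule summable_comparison_test[OF _ summable_divide[OF a]])
    have "norm (b k n) \<le> \<rho> ^ n * norm (a n) / u0 ^ k" for n
    proof (cases "k \<le> n")
      case True
      then have "real (n choose k) * \<bar>s\<bar> ^ (n - k) * u0 ^ k \<le> \<rho> ^ n"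
        unfolding u0(2)[symmetric] binom[symmetric] using u0(1)
        by (intro member_le_sum) auto
      then have "(real (n choose k) * \<bar>s\<bar> ^ (n - k) * u0 ^ k) * norm (a n) \<le> \<rho> ^ n * norm (a n)"
        by (rule mult_right_mono) simp
      then show ?thesis using u0 by (simp add: b_def abs_mult power_abs field_simps)
    next
      case False
      then show ?thesis using u0 by (simp add: b_def binomial_eq_0)
    qed
    then show "\<exists>N. \<forall>n\<ge>N. norm (norm (b k n)) \<le> \<rho> ^ n * norm (a n) / u0 ^ k" by simp
  qed
  have "(\<lambda>k. u ^ k *\<^sub>R (\<Sum>\<^sub>\<infinity>n. b k n)) sums (\<Sum>n. (s + u) ^ n *\<^sub>R a n)" if u: "\<bar>s\<bar> + \<bar>u\<bar> \<le> \<rho>" for u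
  proof -
    let ?S = "\<Sum>n. (s + u) ^ n *\<^sub>R a n"
    have row: "((\<lambda>k. u ^ k *\<^sub>R b k n) has_sum (s + u) ^ n *\<^sub>R a n) UNIV" for n
    proof (rule has_sum_finite_neutralI[of "{..n}"])
      show "(s + u) ^ n *\<^sub>R a n = (\<Sum>k\<le>n. u ^ k *\<^sub>R b k n)"
        unfolding binom[symmetric] by (simp add: b_def scaleR_sum_left mult_ac)
    qed (auto simp: b_def binomial_eq_0)
    have "\<bar>s + u\<bar> \<le> \<rho>" using u by linarith
    then have summ': "summable (\<lambda>n. norm ((s + u) ^ n *\<^sub>R a n))"
      using summ(2)[of "\<bar>s + u\<bar>"] by (simp add: power_abs)
    have "((\<lambda>n. (s + u) ^ n *\<^sub>R a n) has_sum ?S) UNIV"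
      by (rule norm_summable_imp_has_sum[OF summ' summable_sums[OF summable_norm_cancel[OF summ']]])
    then have "((\<lambda>(n, k). u ^ k *\<^sub>R b k n) has_sum ?S) (UNIV \<times> UNIV)"
      using row pairs[OF u] by (intro has_sum_SigmaI) auto
    then have "((\<lambda>(k, n). u ^ k *\<^sub>R b k n) has_sum ?S) (UNIV \<times> UNIV)"
      by (subst (asm) has_sum_swap) simp
    then have "((\<lambda>k. u ^ k *\<^sub>R (\<Sum>\<^sub>\<infinity>n. b k n)) has_sum ?S) UNIV"
      by (rule has_sum_SigmaD) (auto intro!: has_sum_scaleR has_sum_infsum b_summable)
    then show ?thesis by (rule has_sum_imp_sums)
  qed
  then show ?thesis by (intro exI[of _ "\<lambda>k. \<Sum>\<^sub>\<infinity>n. b k n"] allI impI)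
qed

text \<open>Vanishing near a point is a locally constant property: around each point of
  \<open>I\<close> either \<open>f\<close> is zero throughout or zeros other than the centre are
  excluded. Connectedness then carries it from \<open>s0\<close> to \<open>s1\<close>.\<close>

lemma local_powser_identity:
  fixes f :: "real \<Rightarrow> 'b::banach"
  assumes I: "connected I" "open I"
    and f: "\<And>s. s \<in> I \<Longrightarrow> \<exists>c. \<exists>\<delta>>0. \<forall>u. \<bar>u\<bar> < \<delta> \<longrightarrow> (\<lambda>n. u ^ n *\<^sub>R c n) sums f (s + u)"
    and "s0 \<in> I" "\<forall>\<^sub>F z in nhds s0. f z = 0" "s1 \<in> I"
  shows "f s1 = 0"
proof -
  have "\<forall>\<^sub>F z in nhds s1. f z = 0"
  proof (rule connected_induction_simple[OF \<open>connected I\<close> \<open>s0 \<in> I\<close> \<open>s1 \<in> I\<close>, where P = "\<lambda>s. \<forall>\<^sub>F z in nhds s. f z = 0"])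
    show "\<forall>\<^sub>F z in nhds s0. f z = 0" by fact
    fix s assume "s \<in> I"
    then obtain c \<delta> where "0 < \<delta>" and c: "\<And>u. \<bar>u\<bar> < \<delta> \<Longrightarrow> (\<lambda>n. u ^ n *\<^sub>R c n) sums f (s + u)"
      using f by blast
    consider (zero) "\<And>u. \<bar>u\<bar> < \<delta> \<Longrightarrow> f (s + u) = 0"
      | (isolated) e where "0 < e" "\<And>u. 0 < \<bar>u\<bar> \<Longrightarrow> \<bar>u\<bar> < e \<Longrightarrow> f (s + u) \<noteq> 0"
      using powser_isolated_zero[OF \<open>0 < \<delta>\<close>, of c "\<lambda>u. f (s + u)"] c by blast
    then show "\<exists>T. openin (top_of_set I) T \<and> s \<in> T \<and> (\<forall>x\<in>T. \<forall>y\<in>T.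
        (\<forall>\<^sub>F z in nhds x. f z = 0) \<longrightarrow> (\<forall>\<^sub>F z in nhds y. f z = 0))"
    proof cases
      case zero
      have "\<forall>\<^sub>F z in nhds y. f z = 0" if "y \<in> ball s \<delta>" for y
        unfolding eventually_nhds
      proof (intro exI[of _ "ball s \<delta>"] conjI ballI)
        fix z assume "z \<in> ball s \<delta>"
        then show "f z = 0" using zero[of "z - s"] by (simp add: dist_real_def)
      qed (use that in auto)
      moreover have "openin (top_of_set I) (I \<inter> ball s \<delta>)" "s \<in> I \<inter> ball s \<delta>"
        using \<open>0 < \<delta>\<close> \<open>s \<in> I\<close> by (simp_all add: openin_open_Int)
      ultimately show ?thesis by (metis IntD2)
    next
      case isolated
      have "\<not> (\<forall>\<^sub>F z in nhds x. f z = 0)" if "x \<in> ball s e" for x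
      proof
        assume "\<forall>\<^sub>F z in nhds x. f z = 0"
        then obtain d where "0 < d" and d: "\<And>z. dist z x < d \<Longrightarrow> f z = 0"
          unfolding eventually_nhds_metric by blast
        \<comment> \<open>The centre \<open>s\<close> may itself be a zero. If \<open>x = s\<close>,
          a neighbouring point has to serve as the contradicting zero.\<close>
        obtain z where "z \<noteq> s" "dist z x < d" "dist z s < e"
        proof (cases "x = s")
          case True
          show ?thesis
            using \<open>0 < d\<close> \<open>0 < e\<close> True
            by (intro that[of "s + min d e / 2"]) (auto simp: dist_real_def)
        next
          case False
          then show ?thesis using that[of x] \<open>0 < d\<close> \<open>x \<in> ball s e\<close> by (simp add: dist_commute)
        qed
        then show False
          using d[of z] isolated(2)[of "z - s"] by (simp add: dist_real_def)
      qed
      moreover have "openin (top_of_set I) (I \<inter> ball s e)" "s \<in> I \<inter> ball s e"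
        using \<open>0 < e\<close> \<open>s \<in> I\<close> by (simp_all add: openin_open_Int)
      ultimately show ?thesis by (metis IntD2)
    qed
  qed
  then show ?thesis by (rule eventually_nhds_x_imp_x)
qed

section \<open>Taylor expansion on the ball of radius \<open>1 / \<gamma>\<close>\<close>

locale smale_gamma_point =
  fixes F :: "'a::banach \<Rightarrow> 'b::banach" and D :: "nat \<Rightarrow> 'a \<Rightarrow> 'a list \<Rightarrow> 'b"
    and S :: "'a set" and x0 :: 'a and \<gamma> :: real
  assumes analytic: "analytic_with_derivs F D S" and open_S: "open S"
    and bij_deriv: "bij (deriv1 D x0)"
    and \<gamma>_def: "\<gamma> = smale_gamma D x0" and \<gamma>_pos: "0 < \<gamma>"
    and ball_subset: "ball x0 (1 / \<gamma>) \<subseteq> S"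
begin

section \<open>The normalised map and its Taylor coefficients at the starting point\<close>

abbreviation Linv :: "'b \<Rightarrow> 'a" where "Linv \<equiv> inv (deriv1 D x0)"

definition G :: "'a \<Rightarrow> 'a" where "G x = Linv (F x)"
definition G' :: "'a \<Rightarrow> 'a \<Rightarrow> 'a" where "G' x h = Linv (deriv1 D x h)"
definition A :: "nat \<Rightarrow> 'a list \<Rightarrow> 'a" where "A n hs = (1 / fact n) *\<^sub>R Linv (D n x0 hs)"

lemma x0_in: "x0 \<in> S"
  using ball_subset \<gamma>_pos by auto

lemma bounded_multilinear_D: "x \<in> S \<Longrightarrow> bounded_multilinear n (D n x)"
  using analytic by (auto simp: analytic_with_derivs_def has_higher_derivs_def)

lemma D_0: "x \<in> S \<Longrightarrow> D 0 x [] = F x"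
  using analytic by (auto simp: analytic_with_derivs_def has_higher_derivs_def)

lemma bounded_linear_deriv1:
  assumes "x \<in> S"
  shows "bounded_linear (deriv1 D x)"
proof -
  have lin: "linear (\<lambda>h. D 1 x [h])"
    using bounded_multilinear_D[OF assms, of 1] multilinear_linear_head[of 0 "D 1 x" "[]"]
    by (simp add: bounded_multilinear_def)
  show ?thesis
    unfolding deriv1_def
    using bounded_multilinear_norm_le[OF bounded_multilinear_D[OF assms, of 1], of "[_]"]
    by (intro bounded_linear_intro[where K = "mnorm 1 (D 1 x)"] linear_add[OF lin] linear_cmul[OF lin])
      (auto simp: mult.commute)
qed

lemma bounded_linear_Linv: "bounded_linear Linv"
  by (rule bounded_linear_inv[OF bounded_linear_deriv1[OF x0_in] bij_deriv])

lemma Linv_deriv1: "Linv (deriv1 D x0 h) = h"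
  using bij_deriv by (simp add: bij_def)

lemma Linv_eq_0_iff: "Linv y = 0 \<longleftrightarrow> y = 0"
  using bij_deriv bounded_linear.linear[OF bounded_linear_Linv]
  by (metis bij_imp_bij_inv bij_is_inj injD linear_0)

lemma bounded_multilinear_Linv_D:
  assumes "x \<in> S"
  shows "bounded_multilinear n (\<lambda>hs. Linv (D n x hs))"
proof -
  obtain K where K: "\<And>hs. length hs = n \<Longrightarrow> norm (D n x hs) \<le> K * prod_list (map norm hs)"
    and mult: "multilinear n (D n x)"
    using bounded_multilinear_D[OF assms] unfolding bounded_multilinear_def by blast
  obtain L where L: "0 < L" "\<And>y. norm (Linv y) \<le> norm y * L"
    using bounded_linear.pos_bounded[OF bounded_linear_Linv] by blast
  have "norm (Linv (D n x hs)) \<le> (K * L) * prod_list (map norm hs)" if "length hs = n" for hs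
    using order_trans[OF L(2) mult_right_mono[OF K[OF that] less_imp_le[OF L(1)]]]
    by (simp add: mult_ac)
  then show ?thesis
    unfolding bounded_multilinear_def
    using multilinear_compose_linear[OF mult bounded_linear.linear[OF bounded_linear_Linv]] by blast
qed

text \<open>A positive radius of convergence at \<open>x0\<close> lets the coefficients grow at most
  exponentially, so their roots of order \<open>n - 1\<close> stay bounded.\<close>

lemma bdd_above_smale_gamma:
  "bdd_above ((\<lambda>n. (mnorm n (\<lambda>hs. Linv (D n x0 hs)) / fact n) powr (1 / (real n - 1))) ` {2..})"
proof -
  obtain L where L: "0 < L" "\<And>y. norm (Linv y) \<le> norm y * L"
    using bounded_linear.pos_bounded[OF bounded_linear_Linv] by blast
  obtain r where "0 < r" and summ: "summable (\<lambda>n. mnorm n (D n x0) * r ^ n / fact n)"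
    using analytic x0_in by (auto simp: analytic_with_derivs_def)
  obtain K where "0 < K" and K: "\<forall>n. norm (mnorm n (D n x0) * r ^ n / fact n) \<le> K"
    using convergent_imp_Bseq[OF convergentI[OF summable_LIMSEQ_zero[OF summ]]] by (rule BseqE)
  \<comment> \<open>Both \<open>B\<close> and \<open>q\<close> are at least 1, so exponents may be
    raised: \<open>1 \<le> n - 1\<close> and \<open>n \<le> 2 * (n - 1)\<close> for
    \<open>n \<ge> 2\<close> turn the bound into a pure power with exponent
    \<open>n - 1\<close>.\<close>
  define B where "B = max 1 (K * L)"
  define q where "q = max 1 (1 / r)"
  have "(mnorm n (\<lambda>hs. Linv (D n x0 hs)) / fact n) powr (1 / (real n - 1)) \<le> B * q\<^sup>2"
    if n: "2 \<le> n" for n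
  proof -
    have "mnorm n (\<lambda>hs. Linv (D n x0 hs)) \<le> mnorm n (D n x0) * L"
    proof (rule mnorm_least)
      fix hs :: "'a list" assume hs: "length hs = n" "\<forall>h\<in>set hs. norm h \<le> 1"
      have "prod_list (map norm hs) \<le> 1 \<and> 0 \<le> prod_list (map norm hs)"
        using hs(2) by (induction hs) (auto intro: mult_le_one)
      then have "norm (D n x0 hs) \<le> mnorm n (D n x0)"
        using bounded_multilinear_norm_le[OF bounded_multilinear_D[OF x0_in] hs(1)]
          mult_left_mono[of "prod_list (map norm hs)" 1 "mnorm n (D n x0)"]
          mnorm_nonneg[OF bounded_multilinear_D[OF x0_in]] by fastforce
      then show "norm (Linv (D n x0 hs)) \<le> mnorm n (D n x0) * L"
        using L(2)[of "D n x0 hs"] mult_right_mono[of "norm (D n x0 hs)" "mnorm n (D n x0)" L] L(1)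
        by linarith
    qed
    moreover have "mnorm n (D n x0) / fact n \<le> K * (1 / r) ^ n"
      using spec[OF K, of n] \<open>0 < r\<close> by (simp add: power_divide field_simps abs_le_iff)
    ultimately have "mnorm n (\<lambda>hs. Linv (D n x0 hs)) / fact n \<le> (K * (1 / r) ^ n) * L"
      using L(1) by (smt (verit) divide_right_mono fact_ge_zero mult_right_mono times_divide_eq_left)
    also have "\<dots> = (K * L) * (1 / r) ^ n" by (simp add: mult_ac)
    also have "\<dots> \<le> B * q ^ n"
      using \<open>0 < r\<close> L(1) \<open>0 < K\<close> by (intro mult_mono power_mono) (auto simp: B_def q_def)
    also have "\<dots> \<le> B ^ (n - 1) * (q\<^sup>2) ^ (n - 1)"
    proof (intro mult_mono)
      show "B \<le> B ^ (n - 1)" using n by (intro self_le_power) (auto simp: B_def)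
      show "q ^ n \<le> (q\<^sup>2) ^ (n - 1)"
        unfolding power_mult[symmetric] using n by (intro power_increasing) (auto simp: q_def)
    qed (auto simp: B_def q_def)
    also have "\<dots> = (B * q\<^sup>2) ^ (n - 1)" by (simp add: power_mult_distrib)
    finally have le: "mnorm n (\<lambda>hs. Linv (D n x0 hs)) / fact n \<le> (B * q\<^sup>2) ^ (n - 1)" .
    have Bq: "0 < B * q\<^sup>2" by (simp add: B_def q_def)
    have "(mnorm n (\<lambda>hs. Linv (D n x0 hs)) / fact n) powr (1 / (real n - 1))
        \<le> ((B * q\<^sup>2) ^ (n - 1)) powr (1 / (real n - 1))"
      using n le mnorm_nonneg[OF bounded_multilinear_Linv_D[OF x0_in]]
      by (intro powr_mono2) auto
    also have "\<dots> = (B * q\<^sup>2) powr (real (n - 1) * (1 / (real n - 1)))"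
      using Bq by (simp add: powr_realpow[symmetric] powr_powr del: powr_realpow)
    also have "real (n - 1) * (1 / (real n - 1)) = 1" using n by (simp add: of_nat_diff)
    also have "(B * q\<^sup>2) powr 1 = B * q\<^sup>2" using Bq by simp
    finally show ?thesis .
  qed
  then show ?thesis by (intro bdd_aboveI2) auto
qed

lemma multilinear_A: "multilinear n (A n)"
  using multilinear_compose_linear[of n "\<lambda>hs. Linv (D n x0 hs)" "\<lambda>y. (1 / fact n) *\<^sub>R y"]
    bounded_multilinear_Linv_D[OF x0_in, of n]
  by (simp add: bounded_multilinear_def A_def[abs_def] linear_iff scaleR_add_right)

lemma A_0: "A 0 [] = G x0"
  by (simp add: A_def G_def D_0[OF x0_in])

lemma A_1: "A (Suc 0) [h] = h"
  using Linv_deriv1[of h] by (simp add: A_def deriv1_def)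

text \<open>For \<open>m = 0\<close> the coefficient is the identity. For larger \<open>m\<close>
  the arity lies in the range of the supremum defining \<gamma>, whose root of order
  \<open>m\<close> is undone by the power.\<close>

lemma norm_A_le:
  assumes "length hs = Suc m"
  shows "norm (A (Suc m) hs) \<le> \<gamma> ^ m * prod_list (map norm hs)"
proof (cases "m = 0")
  case True
  then show ?thesis using assms A_1 by (auto simp: length_Suc_conv)
next
  case False
  define a where "a = mnorm (Suc m) (\<lambda>hs. Linv (D (Suc m) x0 hs)) / fact (Suc m)"
  have "0 \<le> a"
    unfolding a_def by (intro divide_nonneg_nonneg mnorm_nonneg bounded_multilinear_Linv_D x0_in) simp
  have "a powr (1 / (real (Suc m) - 1)) \<le> \<gamma>"
    unfolding \<gamma>_def smale_gamma_def a_def using False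
    by (intro cSUP_upper bdd_above_smale_gamma) auto
  then have "(a powr (1 / real m)) ^ m \<le> \<gamma> ^ m"
    by (intro power_mono) auto
  moreover have "(a powr (1 / real m)) ^ m = a"
    using \<open>0 \<le> a\<close> False by (cases "a = 0") (auto simp: powr_realpow[symmetric] powr_powr)
  ultimately have "a \<le> \<gamma> ^ m" by simp
  moreover have "0 \<le> prod_list (map norm hs)" by (induction hs) auto
  moreover have "norm (A (Suc m) hs) \<le> a * prod_list (map norm hs)"
    using bounded_multilinear_norm_le[OF bounded_multilinear_Linv_D[OF x0_in] assms]
    by (simp add: A_def a_def divide_right_mono)
  ultimately show ?thesis using mult_right_mono order_trans by blast
qed

lemma line_expansion:
  assumes "x \<in> S"
  shows "\<exists>\<delta>>0. \<forall>s. \<bar>s\<bar> < \<delta> \<longrightarrow>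
    (\<lambda>n. s ^ n *\<^sub>R ((1 / fact n) *\<^sub>R Linv (D n x (replicate n v)))) sums G (x + s *\<^sub>R v)"
proof -
  obtain r where "0 < r"
    and r: "\<And>y. y \<in> ball x r \<Longrightarrow> (\<lambda>n. (1 / fact n) *\<^sub>R D n x (replicate n (y - x))) sums F y"
    using analytic assms by (force simp: analytic_with_derivs_def)
  have "(\<lambda>n. s ^ n *\<^sub>R ((1 / fact n) *\<^sub>R Linv (D n x (replicate n v)))) sums G (x + s *\<^sub>R v)"
    \<comment> \<open>The summand 1 in the denominator covers \<open>v = 0\<close>.\<close>
    if s: "\<bar>s\<bar> < r / (norm v + 1)" for s
  proof -
    have "\<bar>s\<bar> * norm v \<le> \<bar>s\<bar> * (norm v + 1)" by (intro mult_left_mono) auto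
    also have "\<dots> < r" using s by (simp add: pos_less_divide_eq add_nonneg_pos)
    finally have "x + s *\<^sub>R v \<in> ball x r" by (simp add: dist_norm)
    from bounded_linear.sums[OF bounded_linear_Linv r[OF this]]
    have "(\<lambda>n. Linv ((1 / fact n) *\<^sub>R D n x (replicate n (s *\<^sub>R v)))) sums G (x + s *\<^sub>R v)"
      by (simp add: G_def)
    moreover have "D n x (replicate n (s *\<^sub>R v)) = s ^ n *\<^sub>R D n x (replicate n v)" for n
      using multilinear_scaleR[of n "D n x" "replicate n v" "\<lambda>_. s"] bounded_multilinear_D[OF assms, of n]
      by (simp add: bounded_multilinear_def prod_list_replicate)
    ultimately show ?thesis
      by (simp add: linear_cmul[OF bounded_linear.linear[OF bounded_linear_Linv]])
  qed
  then show ?thesis using \<open>0 < r\<close> by (intro exI[of _ "r / (norm v + 1)"]) (simp add: add_nonneg_pos)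
qed

text \<open>Both sides are locally power series along the line through \<open>x0\<close> and \<open>x0 + v\<close>,
  and they agree near \<open>x0\<close>.\<close>
lemma taylor_expansion:
  assumes v: "norm v < 1 / \<gamma>"
  shows "(\<lambda>n. A n (replicate n v)) sums G (x0 + v)"
proof -
  define a where "a = (\<lambda>n. A n (replicate n v))"
  define q where "q = \<gamma> * norm v"
  have q: "0 \<le> q" "q < 1" using v \<gamma>_pos by (auto simp: q_def field_simps)
  \<comment> \<open>Since \<open>q < 1\<close>, this choice gives both \<open>1 < \<rho>\<close>, so
    the target parameter 1 is interior to the interval, and \<open>\<rho> * q < 1\<close>, so the
    whole segment stays in the ball.\<close>
  define \<rho> where "\<rho> = 2 / (1 + q)"
  have \<rho>: "1 < \<rho>" "\<rho> * q < 1" using q by (auto simp: \<rho>_def field_simps)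
  have le: "norm (\<rho> ^ Suc m * norm (a (Suc m))) \<le> (\<rho> * norm v) * (\<rho> * q) ^ m" for m
  proof -
    have "norm (a (Suc m)) \<le> \<gamma> ^ m * norm v ^ Suc m"
      using norm_A_le[of "replicate (Suc m) v" m] by (simp add: a_def prod_list_replicate)
    then have "\<rho> ^ Suc m * norm (a (Suc m)) \<le> \<rho> ^ Suc m * (\<gamma> ^ m * norm v ^ Suc m)"
      using \<rho> by (intro mult_left_mono) auto
    then show ?thesis using \<rho> by (simp add: q_def power_mult_distrib mult_ac abs_mult)
  qed
  have "summable (\<lambda>m. (\<rho> * norm v) * (\<rho> * q) ^ m)"
    using \<rho> q by (intro summable_mult summable_geometric) simp
  then have "summable (\<lambda>m. \<rho> ^ Suc m * norm (a (Suc m)))"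
    by (rule summable_comparison_test[rotated]) (use le in blast)
  then have summ: "summable (\<lambda>n. \<rho> ^ n * norm (a n))"
    by (subst (asm) summable_Suc_iff)
  have sums_a: "(\<lambda>n. s ^ n *\<^sub>R a n) sums (\<Sum>n. s ^ n *\<^sub>R a n)" if s: "\<bar>s\<bar> < \<rho>" for s
  proof -
    have "norm (s ^ n *\<^sub>R a n) \<le> \<rho> ^ n * norm (a n)" for n
      using s by (simp add: power_abs mult_right_mono power_mono)
    then show ?thesis by (intro summable_sums summable_comparison_test[OF _ summ]) blast
  qed
  define f where "f = (\<lambda>s. G (x0 + s *\<^sub>R v) - (\<Sum>n. s ^ n *\<^sub>R a n))"
  have "f 1 = 0"
  proof (rule local_powser_identity[of "{-\<rho><..<\<rho>}" f 0])
    fix s assume "s \<in> {-\<rho><..<\<rho>}"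
    then have s: "\<bar>s\<bar> < \<rho>" by auto
    have "\<gamma> * norm (s *\<^sub>R v) \<le> \<rho> * q"
      using s mult_right_mono[of "\<bar>s\<bar>" \<rho> q] q by (simp add: q_def mult_ac)
    then have "norm (s *\<^sub>R v) < 1 / \<gamma>" using \<rho> \<gamma>_pos by (simp add: field_simps)
    then have x_in: "x0 + s *\<^sub>R v \<in> S" using ball_subset by (auto simp: dist_norm)
    define c where "c = (\<lambda>n. (1 / fact n) *\<^sub>R Linv (D n (x0 + s *\<^sub>R v) (replicate n v)))"
    obtain \<delta> where "0 < \<delta>"
      and c: "\<And>u. \<bar>u\<bar> < \<delta> \<Longrightarrow> (\<lambda>n. u ^ n *\<^sub>R c n) sums G (x0 + s *\<^sub>R v + u *\<^sub>R v)"
      using line_expansion[OF x_in, of v] unfolding c_def by blast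
    obtain c' where c': "\<And>u. \<bar>s\<bar> + \<bar>u\<bar> \<le> \<rho> \<Longrightarrow> (\<lambda>n. u ^ n *\<^sub>R c' n) sums (\<Sum>n. (s + u) ^ n *\<^sub>R a n)"
      using powser_recenter[OF summ s] by blast
    have "(\<lambda>n. u ^ n *\<^sub>R (c n - c' n)) sums f (s + u)" if "\<bar>u\<bar> < min \<delta> (\<rho> - \<bar>s\<bar>)" for u
      using sums_diff[OF c c', of u] that by (simp add: f_def scaleR_diff_right scaleR_add_left add.assoc)
    then show "\<exists>c. \<exists>\<delta>>0. \<forall>u. \<bar>u\<bar> < \<delta> \<longrightarrow> (\<lambda>n. u ^ n *\<^sub>R c n) sums f (s + u)"
      using \<open>0 < \<delta>\<close> s by (intro exI[of _ "\<lambda>n. c n - c' n"] exI[of _ "min \<delta> (\<rho> - \<bar>s\<bar>)"]) auto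
  next
    obtain \<delta> where "0 < \<delta>"
      and \<delta>: "\<And>u. \<bar>u\<bar> < \<delta> \<Longrightarrow> (\<lambda>n. u ^ n *\<^sub>R a n) sums G (x0 + u *\<^sub>R v)"
      using line_expansion[OF x0_in, of v] by (auto simp: a_def A_def)
    have "f u = 0" if "\<bar>u\<bar> < \<delta>" for u
      using sums_unique[OF \<delta>[OF that]] by (simp add: f_def)
    then show "\<forall>\<^sub>F z in nhds 0. f z = 0"
      unfolding eventually_nhds_metric using \<open>0 < \<delta>\<close> by (intro exI[of _ \<delta>]) (simp add: dist_real_def)
  qed (use \<rho> in auto)
  then show ?thesis using sums_a[of 1] \<rho> by (simp add: f_def a_def)
qed

text \<open>The termwise derivative of the Taylor series at \<open>x0 + v\<close>. It carries the
  estimates and is identified with \<open>G'\<close> only afterwards.\<close>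

definition L :: "'a \<Rightarrow> 'a \<Rightarrow> 'a" where "L v h = (\<Sum>m. diag_deriv (Suc m) (A (Suc m)) v h)"

context
  fixes v h :: 'a and t d :: real
  assumes v: "norm v \<le> t" and h: "norm h \<le> d" and t_less: "t < 1 / \<gamma>"
begin

lemma t_d_bounds: "0 \<le> t" "0 \<le> d" "0 \<le> \<gamma> * t" "\<gamma> * t < 1"
proof -
  show "0 \<le> t" "0 \<le> d" by (rule order_trans[OF norm_ge_zero v], rule order_trans[OF norm_ge_zero h])
  then show "0 \<le> \<gamma> * t" "\<gamma> * t < 1" using t_less \<gamma>_pos by (auto simp: field_simps)
qed

lemma norm_diag_deriv_A_le:
  "norm (diag_deriv (Suc m) (A (Suc m)) v h) \<le> d * (real (Suc m) * (\<gamma> * t) ^ m)"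
  using norm_diag_deriv_le[OF v h, of "\<gamma> ^ m" "Suc m" "A (Suc m)"] norm_A_le[of _ m] \<gamma>_pos
  by (simp add: power_mult_distrib mult_ac del: diag_deriv.simps)

lemma deriv_sums: "(\<lambda>m. d * (real (Suc m) * (\<gamma> * t) ^ m)) sums (d / (1 - \<gamma> * t)\<^sup>2)"
  using sums_mult[OF geometric_deriv_sums[of "\<gamma> * t"], of d] t_d_bounds by simp

lemma sums_L: "(\<lambda>m. diag_deriv (Suc m) (A (Suc m)) v h) sums L v h"
  unfolding L_def
  by (intro summable_sums summable_comparison_test[OF _ sums_summable[OF deriv_sums]])
    (use norm_diag_deriv_A_le in blast)

text \<open>The first term of the series is \<open>h\<close> itself; the remaining terms are
  dominated by the derivative series of the geometric series without its first term.\<close>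

lemma norm_L_diff_le: "norm (L v h - h) \<le> (1 / (1 - \<gamma> * t)\<^sup>2 - 1) * d"
proof -
  have "(\<lambda>m. diag_deriv (Suc (Suc m)) (A (Suc (Suc m))) v h) sums (L v h - h)"
    using sums_L unfolding sums_Suc_iff[of "\<lambda>m. diag_deriv (Suc m) (A (Suc m)) v h"]
    by (simp add: A_1 sums_Suc_iff)
  moreover have "(\<lambda>m. d * (real (Suc (Suc m)) * (\<gamma> * t) ^ Suc m)) sums (d / (1 - \<gamma> * t)\<^sup>2 - d)"
    using deriv_sums by (subst sums_Suc_iff[of "\<lambda>m. d * (real (Suc m) * (\<gamma> * t) ^ m)"]) simp
  ultimately have "norm (L v h - h) \<le> d / (1 - \<gamma> * t)\<^sup>2 - d"
    by (rule norm_sums_le) (rule norm_diag_deriv_A_le)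
  then show ?thesis by (simp add: algebra_simps)
qed

text \<open>Termwise comparison with the first-order Taylor remainder of the scalar function
  \<open>x / (1 - \<gamma> * x)\<close>, which is then put in closed form.\<close>

lemma norm_remainder_L_le:
  assumes td: "t + d < 1 / \<gamma>"
  shows "norm (G (x0 + v + h) - G (x0 + v) - L v h) \<le> \<gamma> * d\<^sup>2 / ((1 - \<gamma> * t)\<^sup>2 * (1 - \<gamma> * (t + d)))"
proof -
  have gtd: "0 \<le> \<gamma> * (t + d)" "\<gamma> * (t + d) < 1" using t_d_bounds td \<gamma>_pos by (auto simp: field_simps)
  have "norm (v + h) < 1 / \<gamma>" using norm_triangle_mono[OF v h] td by linarith
  from taylor_expansion[OF this] have "(\<lambda>n. A n (replicate n (v + h))) sums G (x0 + v + h)"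
    by (simp add: add.assoc)
  \<comment> \<open>The constant term is split off because the coefficient bound starts at arity 1;
    it cancels when the two expansions are subtracted.\<close>
  then have 1: "(\<lambda>n. A (Suc n) (replicate (Suc n) (v + h))) sums (G (x0 + v + h) - G x0)"
    by (subst sums_Suc_iff) (simp add: A_0)
  have "norm v < 1 / \<gamma>" using v t_less by simp
  from taylor_expansion[OF this]
  have 2: "(\<lambda>n. A (Suc n) (replicate (Suc n) v)) sums (G (x0 + v) - G x0)"
    by (subst sums_Suc_iff) (simp add: A_0)
  have 3: "(\<lambda>n. A (Suc n) (replicate (Suc n) (v + h)) - A (Suc n) (replicate (Suc n) v)
      - diag_deriv (Suc n) (A (Suc n)) v h) sums (G (x0 + v + h) - G (x0 + v) - L v h)"
    using sums_diff[OF sums_diff[OF 1 2] sums_L] by simp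
  have geo: "(\<lambda>n. x * (\<gamma> * x) ^ n) sums (x / (1 - \<gamma> * x))" if "0 \<le> \<gamma> * x" "\<gamma> * x < 1" for x
    using sums_mult[OF geometric_sums[of "\<gamma> * x"], of x] that by simp
  have 4: "(\<lambda>n. (t + d) * (\<gamma> * (t + d)) ^ n - t * (\<gamma> * t) ^ n - d * (real (Suc n) * (\<gamma> * t) ^ n))
     sums ((t + d) / (1 - \<gamma> * (t + d)) - t / (1 - \<gamma> * t) - d / (1 - \<gamma> * t)\<^sup>2)"
    by (intro sums_diff geo deriv_sums t_d_bounds gtd)
  have "norm (G (x0 + v + h) - G (x0 + v) - L v h)
      \<le> (t + d) / (1 - \<gamma> * (t + d)) - t / (1 - \<gamma> * t) - d / (1 - \<gamma> * t)\<^sup>2"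
  proof (rule norm_sums_le[OF 3 4])
    fix n
    have "norm (A (Suc n) (replicate (Suc n) (v + h)) - A (Suc n) (replicate (Suc n) v)
        - diag_deriv (Suc n) (A (Suc n)) v h)
      \<le> \<gamma> ^ n * ((t + d) ^ Suc n - t ^ Suc n - real (Suc n) * t ^ (Suc n - 1) * d)"
      by (rule norm_multilinear_diag_remainder_le[OF v h multilinear_A]) (use \<gamma>_pos norm_A_le in auto)
    also have "\<dots> = (t + d) * (\<gamma> * (t + d)) ^ n - t * (\<gamma> * t) ^ n - d * (real (Suc n) * (\<gamma> * t) ^ n)"
      unfolding power_mult_distrib by (simp add: algebra_simps)
    finally show "norm (A (Suc n) (replicate (Suc n) (v + h)) - A (Suc n) (replicate (Suc n) v)
        - diag_deriv (Suc n) (A (Suc n)) v h)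
      \<le> (t + d) * (\<gamma> * (t + d)) ^ n - t * (\<gamma> * t) ^ n - d * (real (Suc n) * (\<gamma> * t) ^ n)" .
  qed
  also have "\<dots> = \<gamma> * d\<^sup>2 / ((1 - \<gamma> * t)\<^sup>2 * (1 - \<gamma> * (t + d)))"
  proof -
    define p where "p = 1 - \<gamma> * t"
    define r where "r = 1 - \<gamma> * (t + d)"
    have pr: "p \<noteq> 0" "r \<noteq> 0" "t = (1 - p) / \<gamma>" "t + d = (1 - r) / \<gamma>" "d = (p - r) / \<gamma>"
      using t_d_bounds gtd \<gamma>_pos by (auto simp: p_def r_def field_simps)
    have "(t + d) / r - t / p - d / p\<^sup>2 = \<gamma> * d\<^sup>2 / (p\<^sup>2 * r)"
      unfolding pr(4) unfolding pr(3,5) using pr(1,2) \<gamma>_pos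
      by (simp add: field_simps power2_eq_square)
    then show ?thesis by (simp add: p_def r_def)
  qed
  finally show ?thesis .
qed

end

text \<open>The arity 0 clause of \<open>has_higher_derivs\<close> is Frechet differentiability of
  \<open>F\<close>: the argument list is empty and its product of norms is 1.\<close>

lemma has_derivative_G:
  assumes "x \<in> S"
  shows "(G has_derivative G' x) (at x)"
proof -
  have "(F has_derivative deriv1 D x) (at x within S)"
    unfolding has_derivative_within_alt
  proof (intro conjI allI impI)
    show "bounded_linear (deriv1 D x)" by (rule bounded_linear_deriv1[OF assms])
    fix e :: real assume "0 < e"
    have "\<forall>n. \<forall>e>0. \<exists>d>0. \<forall>y\<in>ball x d \<inter> S. \<forall>hs. length hs = n \<longrightarrow>
        norm (D n y hs - D n x hs - D (Suc n) x ((y - x) # hs)) \<le> e * norm (y - x) * prod_list (map norm hs)"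
      using analytic assms unfolding analytic_with_derivs_def has_higher_derivs_def by blast
    then obtain d where "0 < d" and d: "\<forall>y\<in>ball x d \<inter> S. \<forall>hs. length hs = 0 \<longrightarrow>
        norm (D 0 y hs - D 0 x hs - D (Suc 0) x ((y - x) # hs)) \<le> e * norm (y - x) * prod_list (map norm hs)"
      using \<open>0 < e\<close> by blast
    have "norm (F y - F x - deriv1 D x (y - x)) \<le> e * norm (y - x)" if "y \<in> S" "norm (y - x) < d" for y
      using bspec[OF d, of y] that assms by (simp add: dist_norm norm_minus_commute D_0 deriv1_def)
    then show "\<exists>d>0. \<forall>y\<in>S. norm (y - x) < d \<longrightarrow> norm (F y - F x - deriv1 D x (y - x)) \<le> e * norm (y - x)"
      using \<open>0 < d\<close> by blast
  qed
  then have "(F has_derivative deriv1 D x) (at x)"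
    using at_within_open[OF assms open_S] by simp
  from bounded_linear.has_derivative[OF bounded_linear_Linv this]
  show ?thesis by (simp add: G_def[abs_def] G'_def[abs_def])
qed

text \<open>Along the line \<open>u \<mapsto> x0 + v + u *\<^sub>R h\<close> the remainder is
  quadratic in \<open>u\<close>, so \<open>L v h\<close> is the directional derivative of
  \<open>G\<close>; uniqueness of derivatives does the rest.\<close>

lemma L_eq_G':
  assumes "norm v < 1 / \<gamma>"
  shows "L v h = G' (x0 + v) h"
proof -
  define t where "t = norm v"
  have x: "x0 + v \<in> S" using assms ball_subset by (auto simp: dist_norm)
  have L_scaleR: "L v (u *\<^sub>R h) = u *\<^sub>R L v h" for u
    using suminf_scaleR_right[OF sums_summable[OF sums_L[of v t h "norm h"]], of u] assms
    by (simp add: L_def diag_deriv_scaleR[OF multilinear_A] t_def del: diag_deriv.simps)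
  define R where "R = 1 / \<gamma> - t"
  have "0 < R" using assms by (simp add: R_def t_def)
  \<comment> \<open>Small enough that \<open>t + \<bar>u\<bar> * norm h\<close> stays below
    \<open>1 / \<gamma>\<close>, where the remainder bound is available.\<close>
  define e where "e = R / (norm h + 1)"
  have "0 < e" using \<open>0 < R\<close> by (simp add: e_def add_nonneg_pos)
  have lim: "((\<lambda>u. \<bar>u\<bar> * (\<gamma> * (norm h)\<^sup>2 / ((1 - \<gamma> * t)\<^sup>2 * (1 - \<gamma> * (t + \<bar>u\<bar> * norm h))))) \<longlongrightarrow>
      \<bar>0\<bar> * (\<gamma> * (norm h)\<^sup>2 / ((1 - \<gamma> * t)\<^sup>2 * (1 - \<gamma> * (t + \<bar>0\<bar> * norm h))))) (at (0::real))"
    using assms \<gamma>_pos by (intro tendsto_intros) (auto simp: t_def field_simps)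
  have "((\<lambda>u. G (x0 + v + u *\<^sub>R h)) has_derivative (\<lambda>u. u *\<^sub>R L v h)) (at 0)"
  proof (rule has_derivativeI_sandwich[OF \<open>0 < e\<close> bounded_linear_scaleR_left])
    fix u :: real assume "u \<noteq> 0" "dist u 0 < e"
    then have "\<bar>u\<bar> * (norm h + 1) < R" by (simp add: e_def pos_less_divide_eq add_nonneg_pos)
    then have "\<bar>u\<bar> * norm h < R" by (simp add: distrib_left)
    then have td: "t + \<bar>u\<bar> * norm h < 1 / \<gamma>" by (simp add: R_def)
    have "norm (G (x0 + v + u *\<^sub>R h) - G (x0 + v) - L v (u *\<^sub>R h))
        \<le> \<gamma> * (\<bar>u\<bar> * norm h)\<^sup>2 / ((1 - \<gamma> * t)\<^sup>2 * (1 - \<gamma> * (t + \<bar>u\<bar> * norm h)))"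
      by (rule norm_remainder_L_le) (use assms td in \<open>auto simp: t_def\<close>)
    also have "\<dots> = (\<bar>u\<bar> * (\<gamma> * (norm h)\<^sup>2 / ((1 - \<gamma> * t)\<^sup>2 * (1 - \<gamma> * (t + \<bar>u\<bar> * norm h))))) * norm (u - 0)"
      by (simp add: power2_eq_square)
    finally show "norm (G (x0 + v + u *\<^sub>R h) - G (x0 + v + 0 *\<^sub>R h) - (u - 0) *\<^sub>R L v h) / norm (u - 0)
        \<le> \<bar>u\<bar> * (\<gamma> * (norm h)\<^sup>2 / ((1 - \<gamma> * t)\<^sup>2 * (1 - \<gamma> * (t + \<bar>u\<bar> * norm h))))"
      using \<open>u \<noteq> 0\<close> by (simp add: L_scaleR pos_divide_le_eq del: times_divide_eq_right)
  qed (use lim in simp)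
  moreover have "((\<lambda>u. G (x0 + v + u *\<^sub>R h)) has_derivative (\<lambda>u. G' (x0 + v) (u *\<^sub>R h))) (at 0)"
  proof (rule has_derivative_compose[of "\<lambda>u. x0 + v + u *\<^sub>R h" "\<lambda>u. u *\<^sub>R h" 0 UNIV G "G' (x0 + v)"])
    show "((\<lambda>u. x0 + v + u *\<^sub>R h) has_derivative (\<lambda>u. u *\<^sub>R h)) (at 0)"
      by (auto intro!: derivative_eq_intros)
    show "(G has_derivative G' (x0 + v)) (at (x0 + v + 0 *\<^sub>R h))"
      using has_derivative_G[OF x] by simp
  qed
  ultimately have "(\<lambda>u. u *\<^sub>R L v h) = (\<lambda>u. G' (x0 + v) (u *\<^sub>R h))"
    by (rule has_derivative_unique)
  from fun_cong[OF this, of 1] show ?thesis by simp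
qed

lemma norm_G'_diff_le:
  assumes "norm (x - x0) \<le> t" "t < 1 / \<gamma>"
  shows "norm (G' x h - h) \<le> (1 / (1 - \<gamma> * t)\<^sup>2 - 1) * norm h"
  using norm_L_diff_le[of "x - x0" t h "norm h"] L_eq_G'[of "x - x0" h] assms by simp

lemma norm_G_remainder_le:
  assumes "norm (x - x0) \<le> t" "norm h \<le> d" "t + d < 1 / \<gamma>"
  shows "norm (G (x + h) - G x - G' x h) \<le> \<gamma> * d\<^sup>2 / ((1 - \<gamma> * t)\<^sup>2 * (1 - \<gamma> * (t + d)))"
proof -
  have "t < 1 / \<gamma>" using assms norm_ge_zero[of h] by linarith
  then show ?thesis
    using norm_remainder_L_le[of "x - x0" t h d] L_eq_G'[of "x - x0" h] assms by simp
qed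

end

section \<open>The scalar majorant\<close>

locale smale_majorant =
  fixes \<gamma> b :: real
  assumes \<gamma>_pos: "0 < \<gamma>" and b_pos: "0 < b" and \<gamma>b_less: "b * \<gamma> < 3 - 2 * sqrt 2"
begin

abbreviation f :: "real \<Rightarrow> real" where "f \<equiv> majorant_f \<gamma> b"

definition \<sigma> :: real where "\<sigma> = sqrt (\<gamma> * b)"
definition lam :: real where "lam = b / (sqrt (\<gamma> * b) + \<gamma> * b)"
definition \<kappa> :: real where "\<kappa> = 1 - 2 * sqrt (\<gamma> * b) - \<gamma> * b"

text \<open>The absolute value of the derivative of the majorant on the interval where it decreases.\<close>
definition slope :: "real \<Rightarrow> real" where "slope t = 2 - 1 / (1 - \<gamma> * t)\<^sup>2"

text \<open>The exact first-order Taylor error of \<open>f\<close> (see \<open>f_taylor\<close>);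
  with \<open>u = t + d\<close> it is also the bound obtained for \<open>G\<close>. The identity is
  exact because \<open>f\<close> is a rational function.\<close>

definition remainder :: "real \<Rightarrow> real \<Rightarrow> real" where
  "remainder t u = \<gamma> * (u - t)\<^sup>2 / ((1 - \<gamma> * t)\<^sup>2 * (1 - \<gamma> * u))"

text \<open>The number \<open>3 - 2 * sqrt 2\<close> is the square of
  \<open>sqrt 2 - 1\<close>.\<close>

lemma \<sigma>_pos: "0 < \<sigma>" and \<sigma>_sq: "\<sigma>\<^sup>2 = \<gamma> * b" and \<sigma>_less: "\<sigma> < sqrt 2 - 1"
proof -
  show "0 < \<sigma>" "\<sigma>\<^sup>2 = \<gamma> * b" using \<gamma>_pos b_pos by (simp_all add: \<sigma>_def)
  have "(sqrt 2 - 1)\<^sup>2 = 3 - 2 * sqrt (2 :: real)" by (simp add: power2_diff)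
  then have "\<sigma>\<^sup>2 < (sqrt 2 - 1)\<^sup>2" using \<gamma>b_less \<open>\<sigma>\<^sup>2 = \<gamma> * b\<close> by (simp add: mult.commute)
  then show "\<sigma> < sqrt 2 - 1" by (rule power2_less_imp_less) simp
qed

lemma \<kappa>_eq: "\<kappa> = 2 - (1 + \<sigma>)\<^sup>2"
  using \<sigma>_sq by (simp add: \<kappa>_def \<sigma>_def[symmetric] power2_sum)

lemma \<kappa>_pos: "0 < \<kappa>" and \<kappa>_less_1: "\<kappa> < 1"
proof -
  have "(1 + \<sigma>)\<^sup>2 < (sqrt 2)\<^sup>2" using \<sigma>_pos \<sigma>_less by (intro power_strict_mono) auto
  then show "0 < \<kappa>" by (simp add: \<kappa>_eq)
  have "1\<^sup>2 < (1 + \<sigma>)\<^sup>2" using \<sigma>_pos by (intro power_strict_mono) auto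
  then show "\<kappa> < 1" by (simp add: \<kappa>_eq)
qed

lemma one_minus_lam: "1 - \<gamma> * lam = 1 / (1 + \<sigma>)"
proof -
  have "lam = b / (\<sigma> * (1 + \<sigma>))"
    using \<sigma>_sq by (simp add: lam_def \<sigma>_def[symmetric] power2_eq_square distrib_left)
  then have "\<gamma> * lam = \<sigma>\<^sup>2 / (\<sigma> * (1 + \<sigma>))" by (simp add: \<sigma>_sq)
  also have "\<dots> = \<sigma> / (1 + \<sigma>)" using \<sigma>_pos by (simp add: power2_eq_square)
  finally show ?thesis using \<sigma>_pos by (simp add: field_simps)
qed

lemma lam_pos: "0 < lam"
  using \<gamma>_pos b_pos by (simp add: lam_def add_pos_pos)

lemma lam_bounds: "0 < 1 - \<gamma> * lam" "lam < 1 / \<gamma>"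
proof -
  show "0 < 1 - \<gamma> * lam" using \<sigma>_pos by (simp add: one_minus_lam)
  then show "lam < 1 / \<gamma>" using \<gamma>_pos by (simp add: field_simps)
qed

lemma one_minus_bounds:
  assumes "t \<le> lam"
  shows "1 - \<gamma> * lam \<le> 1 - \<gamma> * t" "0 < 1 - \<gamma> * t" "t < 1 / \<gamma>"
proof -
  have "\<gamma> * t \<le> \<gamma> * lam" using assms \<gamma>_pos by simp
  then show "1 - \<gamma> * lam \<le> 1 - \<gamma> * t" "0 < 1 - \<gamma> * t" using lam_bounds by linarith+
  show "t < 1 / \<gamma>" using assms lam_bounds by linarith
qed

lemma slope_lam: "slope lam = \<kappa>"
  by (simp add: slope_def \<kappa>_eq one_minus_lam power_divide)

lemma f_taylor:
  assumes "1 - \<gamma> * t \<noteq> 0" "1 - \<gamma> * u \<noteq> 0"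
  shows "f u = f t - slope t * (u - t) + remainder t u"
proof -
  define p where "p = 1 - \<gamma> * t"
  define q where "q = 1 - \<gamma> * u"
  have pq: "p \<noteq> 0" "q \<noteq> 0" "t = (1 - p) / \<gamma>" "u = (1 - q) / \<gamma>" "u - t = (p - q) / \<gamma>"
    using assms \<gamma>_pos by (auto simp: p_def q_def field_simps)
  have "u / q - 2 * u = t / p - 2 * t - (2 - 1 / p\<^sup>2) * (u - t) + \<gamma> * (u - t)\<^sup>2 / (p\<^sup>2 * q)"
    unfolding pq(5) unfolding pq(3,4) using pq(1,2) \<gamma>_pos
    by (simp add: field_simps power2_eq_square)
  then show ?thesis by (simp add: majorant_f_def slope_def remainder_def p_def q_def)
qed

lemma f_0: "f 0 = b"
  by (simp add: majorant_f_def)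

lemma f_lam: "f lam = - \<kappa> * lam"
proof -
  have nz: "1 + \<sigma> \<noteq> 0" using \<sigma>_pos by linarith
  have "\<gamma> * lam = 1 - 1 / (1 + \<sigma>)" using one_minus_lam by simp
  also have "\<dots> = \<sigma> / (1 + \<sigma>)" using nz by (simp add: field_simps)
  finally have "\<sigma>\<^sup>2 = (\<gamma> * lam)\<^sup>2 * (1 + \<sigma>)\<^sup>2" using nz by (simp add: power_divide)
  then have "\<gamma> * b = \<gamma> * (\<gamma> * lam\<^sup>2 * (1 + \<sigma>)\<^sup>2)"
    unfolding \<sigma>_sq[symmetric] by (simp add: power2_eq_square)
  \<comment> \<open>Expresses \<open>b\<close> through \<open>lam\<close>, so that the tangency
    claim becomes a multiple of \<open>1 / (1 + \<sigma>) - 1 + \<gamma> * lam\<close>, which is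
    0.\<close>
  then have b: "b = \<gamma> * lam\<^sup>2 * (1 + \<sigma>)\<^sup>2" using \<gamma>_pos by simp
  have "f lam + \<kappa> * lam = lam * (1 + \<sigma>) - lam * (1 + \<sigma>)\<^sup>2 + b"
    by (simp add: majorant_f_def one_minus_lam \<kappa>_eq algebra_simps)
  also have "\<dots> = lam * (1 + \<sigma>)\<^sup>2 * (1 / (1 + \<sigma>) - 1 + \<gamma> * lam)"
    using nz by (subst b) (simp add: field_simps power2_eq_square)
  also have "\<dots> = 0" using one_minus_lam by simp
  finally show ?thesis by simp
qed

lemma slope_bounds:
  assumes "0 \<le> t" "t \<le> lam"
  shows "\<kappa> \<le> slope t" "slope t \<le> 1"
proof -
  have "(1 - \<gamma> * lam)\<^sup>2 \<le> (1 - \<gamma> * t)\<^sup>2" "(1 - \<gamma> * t)\<^sup>2 \<le> 1\<^sup>2"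
    using one_minus_bounds[OF assms(2)] lam_bounds assms \<gamma>_pos by (intro power_mono; simp)+
  then show "\<kappa> \<le> slope t" "slope t \<le> 1"
    unfolding slope_lam[symmetric] slope_def
    using one_minus_bounds[OF assms(2)] lam_bounds by (auto simp: field_simps)
qed

text \<open>All factors of the denominator are smallest at \<open>lam\<close>. The coefficient of
  \<open>(u - t)\<^sup>2\<close> is half the second derivative of \<open>f\<close> at
  \<open>lam\<close>, the form required by the quadratic error estimate.\<close>

lemma remainder_mono:
  assumes "u \<le> lam" "t \<le> u"
  shows "remainder t u \<le> \<gamma> * (u - t)\<^sup>2 / (1 - \<gamma> * lam) ^ 3"
proof -
  have "(1 - \<gamma> * lam)\<^sup>2 * (1 - \<gamma> * lam) \<le> (1 - \<gamma> * t)\<^sup>2 * (1 - \<gamma> * u)"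
    using one_minus_bounds[of t] one_minus_bounds[of u] lam_bounds assms
    by (intro mult_mono power_mono) auto
  moreover have "0 < (1 - \<gamma> * t)\<^sup>2 * (1 - \<gamma> * u)"
    using one_minus_bounds[of t] one_minus_bounds[of u] assms by simp
  moreover have "(1 - \<gamma> * lam) ^ 3 = (1 - \<gamma> * lam)\<^sup>2 * (1 - \<gamma> * lam)"
    by (simp add: power3_eq_cube power2_eq_square)
  ultimately show ?thesis
    unfolding remainder_def using lam_bounds \<gamma>_pos by (simp add: divide_left_mono)
qed

text \<open>The derivative of the majorant is convex, so on \<open>[t, lam]\<close> it lies below its chord.\<close>
lemma remainder_chord:
  assumes "t < lam" "t \<le> u" "u \<le> lam"
  shows "2 * remainder t u * (lam - t) \<le> (u - t)\<^sup>2 * (slope t - \<kappa>)"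
proof -
  define p where "p = 1 - \<gamma> * t"
  define q where "q = 1 - \<gamma> * u"
  define l where "l = 1 - \<gamma> * lam"
  have l: "0 < l" "l \<le> q" "l \<le> p"
    using one_minus_bounds[of t] one_minus_bounds[of u] lam_bounds assms by (auto simp: p_def q_def l_def)
  have p: "0 < p" and q: "0 < q" using l by linarith+
  have diff: "p - l = \<gamma> * (lam - t)" by (simp add: p_def l_def algebra_simps)
  \<comment> \<open>In terms of \<open>p\<close>, \<open>q\<close>, \<open>l\<close> the claim
    reduces to \<open>2 / q \<le> (p + l) / l\<^sup>2\<close>, and \<open>l\<close> is the smallest
    of the three.\<close>
  have "2 * (l * l) \<le> (p + l) * q"
    using mult_mono[of "2 * l" "p + l" l q] l by simp
  then have "2 * (1 / q) \<le> (p + l) / l\<^sup>2"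
    using l q by (simp add: field_simps power2_eq_square)
  then have "(p - l) * ((u - t)\<^sup>2 / p\<^sup>2) * (2 * (1 / q)) \<le> (p - l) * ((u - t)\<^sup>2 / p\<^sup>2) * ((p + l) / l\<^sup>2)"
    using l by (intro mult_left_mono) auto
  also have "\<dots> = (u - t)\<^sup>2 * ((p - l) * (p + l) / (p\<^sup>2 * l\<^sup>2))"
    by simp
  also have "(p - l) * (p + l) / (p\<^sup>2 * l\<^sup>2) = 1 / l\<^sup>2 - 1 / p\<^sup>2"
    using l(1) p by (simp add: field_simps power2_eq_square)
  also have "\<dots> = slope t - \<kappa>"
    by (simp add: slope_lam[symmetric] slope_def p_def l_def)
  finally show ?thesis
    unfolding diff by (simp add: remainder_def p_def q_def mult_ac)
qed

lemma remainder_nonneg: "u \<le> lam \<Longrightarrow> 0 \<le> remainder t u"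
  using one_minus_bounds[of u] \<gamma>_pos by (simp add: remainder_def)

lemma remainder_pos: "t < u \<Longrightarrow> u \<le> lam \<Longrightarrow> 0 < remainder t u"
  using one_minus_bounds[of u] one_minus_bounds[of t] \<gamma>_pos by (simp add: remainder_def)

text \<open>The expansion at \<open>t\<close> is evaluated at \<open>lam\<close>, where
  \<open>f\<close> equals \<open>- \<kappa> * lam\<close>. The strict positivity of the remainder is
  what keeps the scalar iterates strictly below \<open>lam\<close>.\<close>

lemma f_plus_less:
  assumes "t < lam"
  shows "f t + \<kappa> * t < (lam - t) * (slope t - \<kappa>)"
proof -
  have "f lam = f t - slope t * (lam - t) + remainder t lam"
    using one_minus_bounds[of t] lam_bounds assms by (intro f_taylor) auto
  moreover have "0 < remainder t lam" using assms by (intro remainder_pos) auto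
  ultimately have "f t < slope t * (lam - t) - \<kappa> * lam" unfolding f_lam by linarith
  then show ?thesis by (simp add: algebra_simps)
qed

section \<open>The two zeros of the majorant\<close>

definition tstar :: real where
  "tstar = (1 + \<gamma> * b - sqrt (1 - 6 * \<gamma> * b + (\<gamma> * b)\<^sup>2)) / (4 * \<gamma>)"
definition taubar :: real where
  "taubar = (1 + \<gamma> * b + sqrt (1 - 6 * \<gamma> * b + (\<gamma> * b)\<^sup>2)) / (4 * \<gamma>)"

text \<open>Clearing the denominator leaves the quadratic
  \<open>2 * \<gamma> * t\<^sup>2 - (1 + \<gamma> * b) * t + b\<close>, whose roots are
  \<open>tstar\<close> and \<open>taubar\<close>.\<close>

lemma f_factor:
  assumes "1 - \<gamma> * t \<noteq> 0"
  shows "f t * (1 - \<gamma> * t) = 2 * \<gamma> * (t - tstar) * (t - taubar)"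
    and "tstar \<le> taubar" and "taubar < 1 / \<gamma>"
proof -
  define g where "g = \<gamma> * b"
  define w where "w = sqrt (1 - 6 * g + g\<^sup>2)"
  have g: "0 < g" using \<gamma>_pos b_pos by (simp add: g_def)
  have "g < 3 - 2 * sqrt 2" using \<gamma>b_less by (simp add: g_def mult.commute)
  \<comment> \<open>The discriminant equals \<open>(3 - g)\<^sup>2 - 8\<close>.\<close>
  then have "(2 * sqrt 2)\<^sup>2 \<le> (3 - g)\<^sup>2" by (intro power_mono) auto
  then have "0 \<le> 1 - 6 * g + g\<^sup>2" by (simp add: power2_diff power_mult_distrib)
  then have w: "0 \<le> w" "w\<^sup>2 = 1 - 6 * g + g\<^sup>2" by (simp_all add: w_def)
  have "3 - 2 * sqrt 2 < (1::real)"
    by (smt (verit) real_sqrt_ge_one one_less_numeral_iff real_less_rsqrt sqrt2_less_2 one_power2)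
  then have "g < 1" using \<open>g < 3 - 2 * sqrt 2\<close> by linarith
  have "w\<^sup>2 \<le> (1 - g)\<^sup>2" using w g by (simp add: power2_diff)
  then have "w \<le> 1 - g" by (rule power2_le_imp_le) (use \<open>g < 1\<close> in simp)
  have eqs: "tstar = (1 + g - w) / (4 * \<gamma>)" "taubar = (1 + g + w) / (4 * \<gamma>)"
    by (simp_all add: tstar_def taubar_def w_def g_def mult.assoc)
  show "tstar \<le> taubar" unfolding eqs using w \<gamma>_pos by (intro divide_right_mono) auto
  have "taubar \<le> 2 / (4 * \<gamma>)" unfolding eqs using \<open>w \<le> 1 - g\<close> \<gamma>_pos by (intro divide_right_mono) auto
  also have "\<dots> < 1 / \<gamma>" using \<gamma>_pos by (simp add: field_simps)
  finally show "taubar < 1 / \<gamma>" .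
  have b_eq: "b = ((1 + g)\<^sup>2 - w\<^sup>2) / (8 * \<gamma>)"
    unfolding w using \<gamma>_pos by (simp add: g_def power2_sum)
  have "f t * (1 - \<gamma> * t) = t + (b - 2 * t) * (1 - \<gamma> * t)"
    using assms by (simp add: majorant_f_def field_simps)
  also have "\<dots> = 2 * \<gamma> * t\<^sup>2 - (1 + g) * t + b"
    by (simp add: g_def algebra_simps power2_eq_square)
  also have "\<dots> = 2 * \<gamma> * (t - tstar) * (t - taubar)"
    unfolding eqs using \<gamma>_pos by (subst b_eq) (simp add: field_simps power2_eq_square)
  finally show "f t * (1 - \<gamma> * t) = 2 * \<gamma> * (t - tstar) * (t - taubar)" .
qed

text \<open>\<open>f\<close> is negative at \<open>lam\<close>, so \<open>lam\<close> separates the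
  two zeros.\<close>

lemma tstar_less_lam: "tstar < lam" and lam_less_taubar: "lam < taubar"
proof -
  have nz: "1 - \<gamma> * lam \<noteq> 0" using lam_bounds by simp
  have "f lam < 0" using \<kappa>_pos lam_pos by (simp add: f_lam)
  then have "2 * \<gamma> * ((lam - tstar) * (lam - taubar)) < 0"
    using f_factor(1)[OF nz] lam_bounds mult_neg_pos[of "f lam" "1 - \<gamma> * lam"] by (simp add: mult.assoc)
  then have "(lam - tstar) * (lam - taubar) < 0"
    using \<gamma>_pos by (simp add: mult_less_0_iff)
  then show "tstar < lam" "lam < taubar"
    using f_factor(2)[OF nz] by (auto simp: mult_less_0_iff)
qed

lemma le_tstar_if_f_nonneg:
  assumes "t < taubar" "0 \<le> f t"
  shows "t \<le> tstar"
proof -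
  have "t < 1 / \<gamma>" using f_factor(3)[of 0] assms by simp
  then have pos: "0 < 1 - \<gamma> * t" using \<gamma>_pos by (simp add: field_simps)
  then have "0 \<le> 2 * \<gamma> * ((t - tstar) * (t - taubar))"
    using f_factor(1)[of t] assms by (metis mult.assoc less_irrefl less_imp_le mult_nonneg_nonneg)
  then have "0 \<le> (t - tstar) * (t - taubar)" using \<gamma>_pos by (simp add: zero_le_mult_iff)
  then show ?thesis using assms by (auto simp: zero_le_mult_iff)
qed

lemma deriv_f:
  assumes "t < 1 / \<gamma>"
  shows "deriv f t = - slope t"
proof -
  have "1 - \<gamma> * t \<noteq> 0" using assms \<gamma>_pos by (simp add: field_simps)
  then have "(f has_field_derivative - slope t) (at t)"
    unfolding majorant_f_def slope_def
    by (auto intro!: derivative_eq_intros simp: field_simps power2_eq_square)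
  then show ?thesis by (rule DERIV_imp_deriv)
qed

text \<open>\<open>deriv f\<close> is identified with \<open>- slope\<close> only to the left of
  \<open>1 / \<gamma>\<close>, so the difference quotients are matched on \<open>(0, lam)\<close>
  before taking the limit.\<close>

lemma left_deriv_deriv_f: "left_deriv (deriv f) lam = 2 * \<gamma> / (1 - \<gamma> * lam) ^ 3"
proof -
  have nz: "1 - \<gamma> * lam \<noteq> 0" using lam_bounds by simp
  have "((\<lambda>t. (inverse (1 - \<gamma> * t))\<^sup>2 - 2) has_field_derivative 2 * \<gamma> * inverse (1 - \<gamma> * lam) ^ 3) (at_left lam)"
    using nz by (auto intro!: derivative_eq_intros simp: power2_eq_square power3_eq_cube mult_ac)
  moreover have "(\<lambda>t. (inverse (1 - \<gamma> * t))\<^sup>2 - 2) = (\<lambda>t. - slope t)"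
    by (simp add: slope_def divide_inverse power_inverse)
  ultimately have "((\<lambda>t. - slope t) has_field_derivative 2 * \<gamma> / (1 - \<gamma> * lam) ^ 3) (at_left lam)"
    by (simp add: divide_inverse power_inverse)
  then have lim: "((\<lambda>s. (- slope s - - slope lam) / (s - lam)) \<longlongrightarrow> 2 * \<gamma> / (1 - \<gamma> * lam) ^ 3) (at_left lam)"
    by (simp only: has_field_derivative_iff)
  have "\<forall>\<^sub>F s in at_left lam. (- slope s - - slope lam) / (s - lam) = (deriv f lam - deriv f s) / (lam - s)"
    unfolding eventually_at_left_field
  proof (intro exI[of _ 0] conjI allI impI)
    fix s assume "s < lam"
    then have "deriv f s = - slope s" "deriv f lam = - slope lam"
      using lam_bounds by (auto intro: deriv_f)
    then show "(- slope s - - slope lam) / (s - lam) = (deriv f lam - deriv f s) / (lam - s)"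
      using \<open>s < lam\<close> by (simp add: field_simps)
  qed (rule lam_pos)
  from tendsto_cong[OF this] lim
  have "((\<lambda>s. (deriv f lam - deriv f s) / (lam - s)) \<longlongrightarrow> 2 * \<gamma> / (1 - \<gamma> * lam) ^ 3) (at_left lam)"
    by simp
  then show ?thesis
    unfolding left_deriv_def by (intro tendsto_Lim) simp_all
qed

end

section \<open>The inexact Newton iteration under the majorant\<close>

text \<open>The Taylor part enters only through the two scalar estimates on \<open>G'\<close> and on
  the remainder; analyticity is no longer visible.\<close>

locale inexact_newton_majorant = smale_majorant +
  fixes G :: "'a::banach \<Rightarrow> 'a" and G' :: "'a \<Rightarrow> 'a \<Rightarrow> 'a" and x0 :: 'a and \<theta> :: real
  assumes has_derivative_G: "\<And>x. norm (x - x0) < 1 / \<gamma> \<Longrightarrow> (G has_derivative G' x) (at x)"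
    and norm_G'_diff_le: "\<And>x t h. norm (x - x0) \<le> t \<Longrightarrow> t < 1 / \<gamma> \<Longrightarrow>
      norm (G' x h - h) \<le> (1 / (1 - \<gamma> * t)\<^sup>2 - 1) * norm h"
    and norm_G_remainder_le: "\<And>x h t d. norm (x - x0) \<le> t \<Longrightarrow> norm h \<le> d \<Longrightarrow> t + d < 1 / \<gamma> \<Longrightarrow>
      norm (G (x + h) - G x - G' x h) \<le> \<gamma> * d\<^sup>2 / ((1 - \<gamma> * t)\<^sup>2 * (1 - \<gamma> * (t + d)))"
    and norm_G_x0_le: "norm (G x0) \<le> b"
    and \<theta>_nonneg: "0 \<le> \<theta>" and \<theta>_le: "\<theta> \<le> \<kappa> / (2 - \<kappa>)"
begin

lemma \<theta>_bounds: "2 * \<theta> \<le> \<kappa> * (1 + \<theta>)" "\<theta> < 1"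
proof -
  have "\<theta> * (2 - \<kappa>) \<le> \<kappa>" using \<theta>_le \<kappa>_less_1 by (simp add: pos_le_divide_eq)
  then show "2 * \<theta> \<le> \<kappa> * (1 + \<theta>)" by (simp add: algebra_simps)
  have "\<kappa> / (2 - \<kappa>) < 1" using \<kappa>_less_1 by simp
  then show "\<theta> < 1" using \<theta>_le by linarith
qed

text \<open>Scalar iteration: \<open>t\<close> controls the distance to the starting point, \<open>e\<close> is the
  accumulated residual error, so that \<open>f t + e\<close> controls the residual of the iterate.\<close>
definition next_t :: "real \<Rightarrow> real \<Rightarrow> real" where "next_t t e = t + (1 + \<theta>) * (f t + e) / slope t"
definition next_e :: "real \<Rightarrow> real \<Rightarrow> real" where "next_e t e = e + 2 * \<theta> * (f t + e)"

fun scalar_seq :: "nat \<Rightarrow> real \<times> real" where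
  "scalar_seq 0 = (0, 0)"
| "scalar_seq (Suc k) = (case scalar_seq k of (t, e) \<Rightarrow> (next_t t e, next_e t e))"

text \<open>The last clause makes the scalar step nonnegative, hence \<open>t\<close>
  monotone.\<close>

definition admissible :: "real \<Rightarrow> real \<Rightarrow> bool" where
  "admissible t e \<longleftrightarrow> 0 \<le> t \<and> t < lam \<and> 0 \<le> e \<and> e \<le> \<kappa> * t \<and> 0 \<le> f t + e"

lemma next_admissible:
  assumes "admissible t e"
  shows "t \<le> next_t t e"
    and "f (next_t t e) + next_e t e = \<theta> * (f t + e) + remainder t (next_t t e)"
    and "f (next_t t e) + next_e t e \<le> (1 + \<theta>\<^sup>2) / 2 * (f t + e)"
    and "admissible (next_t t e) (next_e t e)"
proof -
  define a where "a = f t + e"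
  define m where "m = slope t"
  define s where "s = (1 + \<theta>) * a / m"
  have t: "0 \<le> t" "t < lam" and e: "0 \<le> e" "e \<le> \<kappa> * t" and a: "0 \<le> a"
    using assms by (auto simp: admissible_def a_def)
  have m: "\<kappa> \<le> m" "m \<le> 1" "0 < m" using slope_bounds[of t] t \<kappa>_pos by (auto simp: m_def)
  have nt: "next_t t e = t + s" and ne: "next_e t e = e + 2 * \<theta> * a"
    by (simp_all add: next_t_def next_e_def s_def a_def m_def)
  have s: "0 \<le> s" "s * m = (1 + \<theta>) * a" using a m \<theta>_nonneg by (auto simp: s_def)
  then show "t \<le> next_t t e" by (simp add: nt)
  have "2 * \<theta> * m \<le> 2 * \<theta> * 1" using m \<theta>_nonneg by (intro mult_left_mono) auto
  \<comment> \<open>Since \<open>m \<le> 1\<close>, the bound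
    \<open>2 * \<theta> \<le> \<kappa> * (1 + \<theta>)\<close> also holds with
    \<open>2 * \<theta> * m\<close> on the left; rearranged, this is the one inequality through
    which the tolerance condition controls step length and contraction.\<close>
  then have m\<kappa>: "(1 + \<theta>) * (m - \<kappa>) \<le> (1 - \<theta>) * m" using \<theta>_bounds by (simp add: algebra_simps)
  have "a < (lam - t) * (m - \<kappa>)" using f_plus_less[OF t(2)] e by (simp add: a_def m_def)
  then have "s * m < (1 + \<theta>) * ((lam - t) * (m - \<kappa>))" using s \<theta>_nonneg by simp
  also have "\<dots> \<le> (lam - t) * ((1 - \<theta>) * m)"
    using mult_left_mono[OF m\<kappa>, of "lam - t"] t by (simp add: mult_ac)
  finally have "s * m < ((1 - \<theta>) * (lam - t)) * m" by (simp add: mult_ac)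
  \<comment> \<open>A step uses less than the fraction \<open>1 - \<theta>\<close> of the distance
    left to \<open>lam\<close>.\<close>
  then have s_less: "s < (1 - \<theta>) * (lam - t)" using m by simp
  have "(1 - \<theta>) * (lam - t) \<le> 1 * (lam - t)" using \<theta>_nonneg t by (intro mult_right_mono) auto
  then have "s < lam - t" using s_less by simp
  then have nt_less: "next_t t e < lam" by (simp add: nt)
  have "f (t + s) = f t - m * s + remainder t (t + s)"
    using f_taylor[of t "t + s"] one_minus_bounds[of t] one_minus_bounds[of "t + s"] t nt_less
    by (simp add: nt m_def)
  \<comment> \<open>Explains the increment of \<open>e\<close>: the linear part lowers
    \<open>f\<close> by \<open>(1 + \<theta>) * a\<close>, and adding
    \<open>2 * \<theta> * a\<close> leaves exactly the tolerated residual
    \<open>\<theta> * a\<close> plus the linearisation error.\<close>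
  then show eq: "f (next_t t e) + next_e t e = \<theta> * (f t + e) + remainder t (next_t t e)"
    using s(2) by (simp add: nt ne a_def[symmetric] algebra_simps) (simp add: a_def algebra_simps)
  \<comment> \<open>The chord bound and the two uses of the factor \<open>1 - \<theta>\<close> give
    a remainder of at most \<open>(1 - \<theta>)\<^sup>2 / 2 * a\<close>; together with
    \<open>\<theta> * a\<close> this is \<open>(1 + \<theta>\<^sup>2) / 2 * a\<close>.\<close>
  have "2 * remainder t (t + s) * (lam - t) \<le> s\<^sup>2 * (m - \<kappa>)"
    using remainder_chord[of t "t + s"] t s nt_less by (simp add: nt m_def)
  also have "\<dots> = s * (m - \<kappa>) * s" by (simp add: power2_eq_square)
  also have "\<dots> \<le> s * (m - \<kappa>) * ((1 - \<theta>) * (lam - t))"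
    using s s_less m by (intro mult_left_mono) auto
  finally have "(2 * remainder t (t + s)) * (lam - t) \<le> (s * (m - \<kappa>) * (1 - \<theta>)) * (lam - t)"
    by (simp add: mult_ac)
  then have "2 * remainder t (t + s) \<le> s * (m - \<kappa>) * (1 - \<theta>)" using t by simp
  also have "s * (m - \<kappa>) \<le> (1 - \<theta>) * a"
  proof -
    have "s * (m - \<kappa>) * m = a * ((1 + \<theta>) * (m - \<kappa>))" using s by (simp add: mult_ac)
    also have "\<dots> \<le> a * ((1 - \<theta>) * m)" using m\<kappa> a by (rule mult_left_mono)
    finally have "(s * (m - \<kappa>)) * m \<le> ((1 - \<theta>) * a) * m" by (simp add: mult_ac)
    then show ?thesis using m by simp
  qed
  finally have "2 * remainder t (t + s) \<le> (1 - \<theta>) * a * (1 - \<theta>)"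
    using \<theta>_bounds by (simp add: mult_right_mono)
  then show "f (next_t t e) + next_e t e \<le> (1 + \<theta>\<^sup>2) / 2 * (f t + e)"
    unfolding eq unfolding nt a_def[symmetric] by (simp add: field_simps power2_eq_square)
  have "2 * \<theta> * a \<le> \<kappa> * s"
  proof -
    have "2 * \<theta> * a * m \<le> 2 * \<theta> * a * 1" using m a \<theta>_nonneg by (intro mult_left_mono) auto
    also have "\<dots> \<le> \<kappa> * (1 + \<theta>) * a" using mult_right_mono[OF \<theta>_bounds(1) a] by simp
    also have "\<dots> = (\<kappa> * s) * m" using s by (simp add: mult_ac)
    finally show ?thesis using m by simp
  qed
  then have "next_e t e \<le> \<kappa> * next_t t e" using e by (simp add: nt ne algebra_simps)
  moreover have "0 \<le> f (next_t t e) + next_e t e"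
    unfolding eq using remainder_nonneg[of "next_t t e" t] nt_less a \<theta>_nonneg by (simp add: a_def)
  ultimately show "admissible (next_t t e) (next_e t e)"
    using t s nt_less e a \<theta>_nonneg by (simp add: admissible_def nt ne)
qed

lemma admissible_0: "admissible 0 0"
  using lam_pos b_pos by (simp add: admissible_def f_0)

definition tk :: "nat \<Rightarrow> real" where "tk k = fst (scalar_seq k)"
definition ek :: "nat \<Rightarrow> real" where "ek k = snd (scalar_seq k)"

lemma tk_simps [simp]: "tk 0 = 0" "tk (Suc k) = next_t (tk k) (ek k)"
  and ek_simps [simp]: "ek 0 = 0" "ek (Suc k) = next_e (tk k) (ek k)"
  by (simp_all add: tk_def ek_def case_prod_beta)

lemma admissible_k: "admissible (tk k) (ek k)"
  by (induction k) (simp_all add: admissible_0 next_admissible(4))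

lemma tk_bounds: "0 \<le> tk k" "tk k < lam" "tk k < 1 / \<gamma>"
  using admissible_k[of k] lam_bounds by (auto simp: admissible_def)

lemma residual_k_le: "f (tk k) + ek k \<le> ((1 + \<theta>\<^sup>2) / 2) ^ k * b"
proof (induction k)
  case (Suc k)
  have "f (tk (Suc k)) + ek (Suc k) \<le> (1 + \<theta>\<^sup>2) / 2 * (f (tk k) + ek k)"
    using next_admissible(3)[OF admissible_k] by simp
  also have "\<dots> \<le> (1 + \<theta>\<^sup>2) / 2 * (((1 + \<theta>\<^sup>2) / 2) ^ k * b)"
    using Suc by (intro mult_left_mono) auto
  finally show ?case by (simp add: mult_ac)
qed (simp add: f_0)

section \<open>Comparison of the Newton iterates with the scalar sequence\<close>

lemma slope_norm_le:
  assumes "norm (x - x0) \<le> t" "t \<le> lam"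
  shows "slope t * norm h \<le> norm (G' x h)"
    and "norm (h - G' x h) \<le> (1 - slope t) * norm h"
    and "norm (G' x h) \<le> (2 - slope t) * norm h"
proof -
  have le: "norm (G' x h - h) \<le> (1 - slope t) * norm h"
    using norm_G'_diff_le[of x t h] one_minus_bounds[of t] assms by (simp add: slope_def)
  then show "norm (h - G' x h) \<le> (1 - slope t) * norm h" by (simp add: norm_minus_commute)
  have "norm h \<le> norm (G' x h) + norm (G' x h - h)"
    using norm_triangle_ineq4[of "G' x h" "G' x h - h"] by simp
  with le show "slope t * norm h \<le> norm (G' x h)" by (simp add: algebra_simps)
  have "norm (G' x h) \<le> norm h + norm (G' x h - h)" by (rule norm_triangle_sub)
  with le show "norm (G' x h) \<le> (2 - slope t) * norm h" by (simp add: algebra_simps)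
qed

lemma linear_G': "norm (x - x0) < 1 / \<gamma> \<Longrightarrow> linear (G' x)"
  by (rule has_derivative_linear[OF has_derivative_G])

text \<open>An exact step is a fixed point of \<open>s \<mapsto> s - (G x + G' x s)\<close>, a
  contraction with factor \<open>1 - slope t\<close>.\<close>

lemma ex_newton_step:
  assumes "norm (x - x0) \<le> t" "t < lam" "0 \<le> t"
  shows "\<exists>s. G x + G' x s = 0"
proof -
  have lin: "linear (G' x)" using assms lam_bounds by (intro linear_G') simp
  have m: "0 < slope t" "slope t \<le> 1" using slope_bounds[of t] assms \<kappa>_pos by auto
  have contr: "dist (s - (G x + G' x s)) (s' - (G x + G' x s')) \<le> (1 - slope t) * dist s s'" for s s'
    using slope_norm_le(2)[OF assms(1), of "s - s'"] assms
    by (simp add: dist_norm linear_diff[OF lin] algebra_simps)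
  have "\<exists>!s. s - (G x + G' x s) = s"
    by (rule banach_fix_type[OF _ _ allI[OF allI[OF contr]]]) (use m in simp_all)
  from ex1_implies_ex[OF this] obtain s where s: "s - (G x + G' x s) = s" by (rule exE)
  have "G x + G' x s = s - (s - (G x + G' x s))" by simp
  also have "\<dots> = 0" by (simp only: s diff_self)
  finally show ?thesis by blast
qed

text \<open>The lower bound \<open>slope t\<close> for \<open>G' x\<close> controls the step length.
  The new residual is at most the linearisation error plus the tolerated residual, which is how
  \<open>f + e\<close> evolves by \<open>next_admissible(2)\<close>.\<close>

lemma newton_step:
  assumes adm: "admissible t e" and x: "norm (x - x0) \<le> t" "norm (G x) \<le> f t + e"
    and s: "norm (G x + G' x s) \<le> \<theta> * norm (G x)"
  shows "norm s \<le> next_t t e - t" and "norm (x + s - x0) \<le> next_t t e"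
    and "norm (G (x + s)) \<le> f (next_t t e) + next_e t e"
proof -
  have t: "0 \<le> t" "t < lam" using adm by (auto simp: admissible_def)
  have m: "0 < slope t" using slope_bounds[of t] t \<kappa>_pos by auto
  have "slope t * norm s \<le> norm (G' x s)" using slope_norm_le(1)[OF x(1)] t by simp
  also have "\<dots> \<le> norm (G x + G' x s) + norm (G x)"
    using norm_triangle_ineq4[of "G x + G' x s" "G x"] by simp
  also have "\<dots> \<le> (1 + \<theta>) * norm (G x)" using s by (simp add: algebra_simps)
  also have "\<dots> \<le> (1 + \<theta>) * (f t + e)" using x \<theta>_nonneg by (intro mult_left_mono) auto
  finally show le: "norm s \<le> next_t t e - t"
    using m by (simp add: next_t_def pos_le_divide_eq mult.commute)
  have "norm (x + s - x0) \<le> norm (x - x0) + norm s"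
    using norm_triangle_ineq[of "x - x0" s] by (simp add: algebra_simps)
  then show "norm (x + s - x0) \<le> next_t t e" using le x by linarith
  have "next_t t e < lam" using next_admissible(4)[OF adm] by (simp add: admissible_def)
  then have "norm (G (x + s) - G x - G' x s) \<le> remainder t (next_t t e)"
    using norm_G_remainder_le[OF x(1) le] lam_bounds by (simp add: remainder_def)
  moreover have "norm (G (x + s)) \<le> norm (G (x + s) - G x - G' x s) + norm (G x + G' x s)"
    using norm_triangle_ineq[of "G (x + s) - G x - G' x s" "G x + G' x s"] by simp
  moreover have "\<theta> * norm (G x) \<le> \<theta> * (f t + e)" using x \<theta>_nonneg by (intro mult_left_mono) auto
  ultimately show "norm (G (x + s)) \<le> f (next_t t e) + next_e t e"
    unfolding next_admissible(2)[OF adm] using s by linarith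
qed

text \<open>Only the first \<open>k\<close> steps are constrained, so this covers partial sequences,
  as well-definedness demands, and infinite ones alike.\<close>

lemma newton_iterates:
  assumes "x 0 = x0" "\<And>j. j < k \<Longrightarrow> norm (G (x j) + G' (x j) (x (Suc j) - x j)) \<le> \<theta> * norm (G (x j))"
  shows "norm (x k - x0) \<le> tk k" "norm (G (x k)) \<le> f (tk k) + ek k"
  using assms(2)
proof (induction k)
  case 0
  { case 1 show ?case by (simp add: assms(1)) next
    case 2 show ?case using norm_G_x0_le by (simp add: assms(1) f_0) }
next
  case (Suc k)
  { case 1
    then have IH: "norm (x k - x0) \<le> tk k" "norm (G (x k)) \<le> f (tk k) + ek k" using Suc.IH by simp_all
    show ?case using newton_step(2)[OF admissible_k IH, of "x (Suc k) - x k"] 1[of k] by simp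
  next
    case 2
    then have IH: "norm (x k - x0) \<le> tk k" "norm (G (x k)) \<le> f (tk k) + ek k" using Suc.IH by simp_all
    show ?case using newton_step(3)[OF admissible_k IH, of "x (Suc k) - x k"] 2[of k] by simp }
qed

lemma newton_well_defined:
  assumes "x 0 = x0" "\<And>j. j < k \<Longrightarrow> norm (G (x j) + G' (x j) (x (Suc j) - x j)) \<le> \<theta> * norm (G (x j))"
  shows "norm (x k - x0) < lam" "\<exists>s. G (x k) + G' (x k) s = 0"
proof -
  have "norm (x k - x0) \<le> tk k" using assms by (rule newton_iterates(1))
  then show "norm (x k - x0) < lam" "\<exists>s. G (x k) + G' (x k) s = 0"
    using tk_bounds[of k] ex_newton_step[of "x k" "tk k"] by simp_all
qed

text \<open>At \<open>x0\<close> the derivative is the identity, so the Taylor bound at a zero at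
  distance \<open>t\<close> says \<open>t \<le> b + remainder 0 t\<close>, that is
  \<open>0 \<le> f t\<close>; below \<open>taubar\<close> this forces
  \<open>t \<le> tstar\<close>.\<close>

lemma zero_in_cball_tstar:
  assumes "norm (y - x0) < taubar" "G y = 0"
  shows "norm (y - x0) \<le> tstar"
proof (rule le_tstar_if_f_nonneg[OF assms(1)])
  define t where "t = norm (y - x0)"
  have t: "0 \<le> t" "t < 1 / \<gamma>" using assms f_factor(3)[of 0] by (auto simp: t_def)
  have nz: "1 - \<gamma> * t \<noteq> 0" using t \<gamma>_pos by (simp add: field_simps)
  have "norm (G' x0 (y - x0) - (y - x0)) \<le> 0"
    using norm_G'_diff_le[of x0 0 "y - x0"] \<gamma>_pos by simp
  then have id: "G' x0 (y - x0) = y - x0" by simp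
  have "norm (G y - G x0 - (y - x0)) \<le> remainder 0 t"
    using norm_G_remainder_le[of x0 0 "y - x0" t] t by (simp add: id t_def remainder_def)
  then have "t \<le> norm (G x0) + remainder 0 t"
    using norm_triangle_ineq4[of "- G x0 - (y - x0)" "- G x0"] assms(2)
    by (simp add: t_def norm_minus_commute)
  moreover have "f t = b - t + remainder 0 t"
    using f_taylor[of 0 t] nz by (simp add: f_0 slope_def)
  ultimately show "0 \<le> f (norm (y - x0))" using norm_G_x0_le by (simp add: t_def)
qed

text \<open>Both zeros lie in the ball of radius \<open>tstar < lam\<close>, where
  \<open>x \<mapsto> x - G x\<close> is a contraction because \<open>slope tstar\<close> is
  positive.\<close>

lemma zero_unique:
  assumes "norm (y - x0) < taubar" "G y = 0" "norm (z - x0) < taubar" "G z = 0"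
  shows "y = z"
proof (rule ccontr)
  assume "y \<noteq> z"
  have yz: "y \<in> cball x0 tstar" "z \<in> cball x0 tstar"
    using zero_in_cball_tstar[of y] zero_in_cball_tstar[of z] assms
    by (simp_all add: dist_norm norm_minus_commute)
  have ts: "0 \<le> tstar" using yz zero_le_dist order_trans by (metis mem_cball)
  have m: "0 < slope tstar" using slope_bounds[of tstar] ts tstar_less_lam \<kappa>_pos by auto
  have "norm ((\<lambda>x. x - G x) y - (\<lambda>x. x - G x) z) \<le> (1 - slope tstar) * norm (y - z)"
  proof (rule differentiable_bound[OF convex_cball _ _ yz])
    fix x assume "x \<in> cball x0 tstar"
    then have x: "norm (x - x0) \<le> tstar" by (simp add: dist_norm norm_minus_commute)
    then have "(G has_derivative G' x) (at x)"
      using tstar_less_lam lam_bounds by (intro has_derivative_G) linarith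
    then show "((\<lambda>x. x - G x) has_derivative (\<lambda>h. h - G' x h)) (at x within cball x0 tstar)"
      by (rule has_derivative_at_withinI[OF has_derivative_diff[OF has_derivative_ident]])
    show "onorm (\<lambda>h. h - G' x h) \<le> 1 - slope tstar"
      using slope_norm_le(2)[OF x] tstar_less_lam slope_bounds[of tstar] ts by (intro onorm_bound) auto
  qed
  then have "slope tstar * norm (y - z) \<le> 0" using assms by (simp add: algebra_simps)
  then show False using m \<open>y \<noteq> z\<close> by (simp add: mult_le_0_iff)
qed

text \<open>\<open>G' x\<close> maps the new error to minus the linearisation error at
  \<open>z\<close> minus the Newton residual, and \<open>slope t\<close> bounds \<open>G' x\<close>
  from below. The bound \<open>lam - t\<close> on the old error keeps \<open>t + d\<close> in the
  range of the scalar estimates.\<close>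

lemma newton_error:
  assumes x: "norm (x - x0) \<le> t" and t: "0 \<le> t" "t < lam"
    and s: "norm (G x + G' x s) \<le> \<theta> * norm (G x)"
    and z: "G z = 0" "norm (z - x) \<le> lam - t"
  shows "norm (z - (x + s)) \<le>
      ((1 + \<theta>) / 2 * (2 * \<gamma> / (1 - \<gamma> * lam) ^ 3 / \<kappa>) * norm (z - x) + \<theta> * ((2 - \<kappa>) / \<kappa>)) * norm (z - x)"
    and "norm (z - (x + s)) \<le> ((1 + \<theta>) / 2 + 2 * \<theta> / \<kappa>) * norm (z - x)"
proof -
  define d where "d = norm (z - x)"
  define m where "m = slope t"
  define E where "E = remainder t (t + d)"
  have m: "\<kappa> \<le> m" "m \<le> 1" "0 < m" using slope_bounds[of t] t \<kappa>_pos by (auto simp: m_def)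
  have d: "0 \<le> d" "t + d \<le> lam" using z by (auto simp: d_def)
  have lin: "linear (G' x)" using x t lam_bounds by (intro linear_G') simp
  have E: "norm (G z - G x - G' x (z - x)) \<le> E"
    using norm_G_remainder_le[OF x order_refl, of "z - x"] d lam_bounds
    by (simp add: d_def[symmetric] E_def remainder_def)
  have E_nonneg: "0 \<le> E" using d by (simp add: E_def remainder_nonneg)
  \<comment> \<open>The residual at \<open>x\<close> is measured from the zero \<open>z\<close>, so
    that the tolerance term is bounded by a multiple of the error \<open>d\<close>.\<close>
  have "norm (G x) \<le> norm (G z - G x - G' x (z - x)) + norm (G' x (z - x))"
    using norm_triangle_ineq[of "G z - G x - G' x (z - x)" "G' x (z - x)"] z by simp
  also have "\<dots> \<le> E + (2 - m) * d"
    using slope_norm_le(3)[OF x, of "z - x"] t E by (intro add_mono) (auto simp: m_def d_def)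
  finally have Gx: "norm (G x) \<le> E + (2 - m) * d" .
  have "m * norm (z - (x + s)) \<le> norm (G' x (z - (x + s)))"
    using slope_norm_le(1)[OF x] t by (simp add: m_def)
  also have "G' x (z - (x + s)) = - (G z - G x - G' x (z - x)) - (G x + G' x s)"
    using z linear_diff[OF lin, of "z - x" s] by (simp add: diff_diff_eq)
  also have "norm \<dots> \<le> norm (G z - G x - G' x (z - x)) + norm (G x + G' x s)"
    using norm_triangle_ineq4[of "- (G z - G x - G' x (z - x))" "G x + G' x s"]
    unfolding norm_minus_cancel .
  also have "\<dots> \<le> E + \<theta> * (E + (2 - m) * d)"
    using E s mult_left_mono[OF Gx \<theta>_nonneg] by linarith
  finally have "norm (z - (x + s)) \<le> (E + \<theta> * (E + (2 - m) * d)) / m"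
    using m by (simp add: pos_le_divide_eq mult.commute)
  also have "\<dots> = (1 + \<theta>) * (E / m) + \<theta> * ((2 - m) / m) * d"
    using m by (simp add: field_simps)
  finally have main: "norm (z - (x + s)) \<le> (1 + \<theta>) * (E / m) + \<theta> * ((2 - m) / m) * d" .
  have "(2 - m) / m \<le> (2 - \<kappa>) / \<kappa>" using m \<kappa>_pos \<kappa>_less_1 by (intro frac_le) auto
  then have res: "\<theta> * ((2 - m) / m) * d \<le> \<theta> * ((2 - \<kappa>) / \<kappa>) * d"
    using \<theta>_nonneg d by (intro mult_right_mono mult_left_mono) auto
  define Q where "Q = 2 * \<gamma> / (1 - \<gamma> * lam) ^ 3"
  have "E \<le> Q / 2 * d\<^sup>2"
    using remainder_mono[of "t + d" t] d by (simp add: E_def Q_def)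
  then have "E / m \<le> Q / 2 * d\<^sup>2 / \<kappa>"
    using E_nonneg m \<kappa>_pos by (intro frac_le) auto
  then have "(1 + \<theta>) * (E / m) \<le> (1 + \<theta>) * (Q / 2 * d\<^sup>2 / \<kappa>)"
    using \<theta>_nonneg by (intro mult_left_mono) auto
  also have "\<dots> = (1 + \<theta>) / 2 * (Q / \<kappa>) * d * d" by (simp add: power2_eq_square)
  finally have "norm (z - (x + s)) \<le> ((1 + \<theta>) / 2 * (Q / \<kappa>) * d + \<theta> * ((2 - \<kappa>) / \<kappa>)) * d"
    using main res by (simp add: distrib_right)
  then show "norm (z - (x + s)) \<le>
      ((1 + \<theta>) / 2 * (2 * \<gamma> / (1 - \<gamma> * lam) ^ 3 / \<kappa>) * norm (z - x) + \<theta> * ((2 - \<kappa>) / \<kappa>)) * norm (z - x)"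
    by (simp add: Q_def d_def)
  \<comment> \<open>For the linear estimate the chord bound and \<open>d \<le> lam - t\<close> give
    \<open>E / m \<le> d / 2\<close>, free of the second derivative.\<close>
  have "2 * E * (lam - t) \<le> d * (m - \<kappa>) * d"
    using remainder_chord[of t "t + d"] t d by (simp add: E_def m_def power2_eq_square mult_ac)
  also have "\<dots> \<le> d * (m - \<kappa>) * (lam - t)" using d m by (intro mult_left_mono) auto
  finally have "2 * E \<le> d * (m - \<kappa>)" using t by simp
  also have "\<dots> \<le> d * m" using d \<kappa>_pos by (intro mult_left_mono) auto
  finally have "E / m \<le> d / 2" using m by (simp add: field_simps)
  then have "(1 + \<theta>) * (E / m) \<le> (1 + \<theta>) / 2 * d"
    using mult_left_mono[of "E / m" "d / 2" "1 + \<theta>"] \<theta>_nonneg by simp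
  moreover have "\<theta> * ((2 - \<kappa>) / \<kappa>) * d \<le> 2 * \<theta> / \<kappa> * d"
    using \<theta>_nonneg d \<kappa>_pos by (intro mult_right_mono) (auto simp: field_simps)
  ultimately show "norm (z - (x + s)) \<le> ((1 + \<theta>) / 2 + 2 * \<theta> / \<kappa>) * norm (z - x)"
    using main res unfolding distrib_right d_def[symmetric] by linarith
qed

context
  fixes x :: "nat \<Rightarrow> 'a"
  assumes x_0: "x 0 = x0"
    and x_step: "\<And>k. norm (G (x k) + G' (x k) (x (Suc k) - x k)) \<le> \<theta> * norm (G (x k))"
begin

lemma iterates_bounds: "norm (x k - x0) \<le> tk k" "norm (G (x k)) \<le> f (tk k) + ek k"
  by (rule newton_iterates[OF x_0 x_step])+

lemma residual_le: "norm (G (x k)) \<le> ((1 + \<theta>\<^sup>2) / 2) ^ k * b"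
  using iterates_bounds(2)[of k] residual_k_le[of k] by linarith

lemma iterates_dist: "norm (x (k + j) - x k) \<le> tk (k + j) - tk k"
proof (induction j)
  case (Suc j)
  have "norm (x (Suc (k + j)) - x (k + j)) \<le> tk (Suc (k + j)) - tk (k + j)"
    using newton_step(1)[OF admissible_k iterates_bounds x_step] by simp
  then show ?case
    using Suc norm_triangle_ineq[of "x (Suc (k + j)) - x (k + j)" "x (k + j) - x k"]
    by (simp del: tk_simps)
qed simp

text \<open>Distances between iterates are dominated by increments of the bounded increasing
  sequence \<open>tk\<close>, and the residuals decay geometrically. The bound
  \<open>lam - tk k\<close> is what \<open>newton_error\<close> asks of the zero.\<close>

lemma iterates_converge:
  obtains z where "x \<longlonglongrightarrow> z" "G z = 0" "\<And>k. norm (z - x k) \<le> lam - tk k" "norm (z - x0) \<le> lam"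
proof -
  have "incseq tk"
    using next_admissible(1)[OF admissible_k] by (intro incseq_SucI) simp
  then obtain T where T: "tk \<longlonglongrightarrow> T" "\<And>k. tk k \<le> T"
    using incseq_convergent[of tk lam] tk_bounds less_imp_le by blast
  have "T \<le> lam" using T(1) by (rule LIMSEQ_le_const2) (use tk_bounds less_imp_le in blast)
  have "Cauchy x"
    unfolding Cauchy_altdef2
  proof (intro allI impI)
    fix e :: real assume "0 < e"
    then obtain N where N: "\<And>k. N \<le> k \<Longrightarrow> \<bar>tk k - T\<bar> < e"
      using T(1) unfolding LIMSEQ_def dist_real_def by blast
    have "dist (x n) (x N) < e" if "N \<le> n" for n
    proof -
      have "norm (x n - x N) \<le> tk n - tk N" using iterates_dist[of N "n - N"] that by simp
      also have "\<dots> \<le> T - tk N" using T(2)[of n] by simp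
      also have "\<dots> < e" using N[of N] by simp
      finally show ?thesis by (simp add: dist_norm)
    qed
    then show "\<exists>N. \<forall>n\<ge>N. dist (x n) (x N) < e" by blast
  qed
  then obtain z where z: "x \<longlonglongrightarrow> z" using Cauchy_convergent convergent_def by blast
  have z_dist: "norm (z - x k) \<le> lam - tk k" for k
  proof (rule LIMSEQ_le_const2)
    show "(\<lambda>n. norm (x n - x k)) \<longlonglongrightarrow> norm (z - x k)" by (intro tendsto_intros z)
    have "norm (x n - x k) \<le> lam - tk k" if "k \<le> n" for n
      using iterates_dist[of k "n - k"] tk_bounds[of n] that by simp
    then show "\<exists>N. \<forall>n\<ge>N. norm (x n - x k) \<le> lam - tk k" by blast
  qed
  have z_x0: "norm (z - x0) \<le> lam" using z_dist[of 0] by (simp add: x_0)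
  have "isCont G z"
    using has_derivative_G[of z] z_x0 lam_bounds has_derivative_continuous by fastforce
  then have "(\<lambda>k. G (x k)) \<longlonglongrightarrow> G z" using z by (rule isCont_tendsto_compose)
  moreover have "(\<lambda>k. G (x k)) \<longlonglongrightarrow> 0"
  proof (rule Lim_null_comparison[OF always_eventually[OF allI[OF residual_le]]])
    have "\<theta>\<^sup>2 < 1" using \<theta>_bounds \<theta>_nonneg by (simp add: power_less_one_iff)
    then have "(\<lambda>k. ((1 + \<theta>\<^sup>2) / 2) ^ k) \<longlonglongrightarrow> 0" by (intro LIMSEQ_power_zero) simp
    then show "(\<lambda>k. ((1 + \<theta>\<^sup>2) / 2) ^ k * b) \<longlonglongrightarrow> 0" by (rule tendsto_mult_left_zero)
  qed
  ultimately have "G z = 0" by (rule LIMSEQ_unique)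
  then show ?thesis using that z z_dist z_x0 by blast
qed

end

end

section \<open>Convergence under the alpha-condition of Smale\<close>

theorem theorem6p1:
  fixes F :: "'a::banach \<Rightarrow> 'b::banach"
    and D :: "nat \<Rightarrow> 'a \<Rightarrow> 'a list \<Rightarrow> 'b"
    and C :: "'a set" and x0 :: 'a and b \<theta> :: real
  defines "\<gamma> \<equiv> smale_gamma D x0"
  defines "Linv \<equiv> inv (deriv1 D x0)"
  defines "lam \<equiv> b / (sqrt (\<gamma> * b) + \<gamma> * b)"
  defines "t_star \<equiv> (1 + \<gamma> * b - sqrt (1 - 6 * \<gamma> * b + (\<gamma> * b)\<^sup>2)) / (4 * \<gamma>)"
  defines "\<tau>_bar \<equiv> (1 + \<gamma> * b + sqrt (1 - 6 * \<gamma> * b + (\<gamma> * b)\<^sup>2)) / (4 * \<gamma>)"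
  defines "f' \<equiv> deriv (majorant_f \<gamma> b)"
  assumes cont: "continuous_on C F"
    and analytic: "analytic_with_derivs F D (interior C)"
    and x0_int: "x0 \<in> interior C"
    and nonsing: "bij (deriv1 D x0)"
    and gamma_pos: "\<gamma> > 0"
    and ball_sub: "ball x0 (1 / \<gamma>) \<subseteq> C"
    and b_pos: "b > 0"
    and init: "norm (Linv (F x0)) \<le> b"
    and gb: "b * \<gamma> < 3 - 2 * sqrt 2"
    and theta_nn: "0 \<le> \<theta>"
    and theta_le: "\<theta> \<le> (1 - 2 * sqrt (\<gamma> * b) - \<gamma> * b) / (1 + 2 * sqrt (\<gamma> * b) + \<gamma> * b)"
  shows
    \<comment> \<open>well-definedness: every partial inexact Newton sequence stays in int(C)
        and admits a next step\<close>
    "(\<forall>k (x :: nat \<Rightarrow> 'a). x 0 = x0 \<and>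
         (\<forall>j<k. inexact_newton_step F (deriv1 D) Linv \<theta> (x j) (x (Suc j) - x j))
       \<longrightarrow> x k \<in> interior C \<and> (\<exists>s. inexact_newton_step F (deriv1 D) Linv \<theta> (x k) s))
   \<and> (\<forall>x :: nat \<Rightarrow> 'a. x 0 = x0 \<and>
         (\<forall>k. inexact_newton_step F (deriv1 D) Linv \<theta> (x k) (x (Suc k) - x k))
       \<longrightarrow> (\<exists>x_star. x \<longlonglongrightarrow> x_star \<and> F x_star = 0
            \<and> (\<forall>k. norm (Linv (F (x k))) \<le> ((1 + \<theta>\<^sup>2) / 2) ^ k * b)
            \<and> (\<forall>k. x k \<in> ball x0 lam)
            \<and> x_star \<in> cball x0 t_star
            \<and> (\<forall>y\<in>ball x0 \<tau>_bar. F y = 0 \<longrightarrow> y = x_star)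
            \<and> (\<forall>k. norm (x_star - x (Suc k)) \<le>
                 ((1 + \<theta>) / 2 * (left_deriv f' lam / \<bar>f' lam\<bar>) * norm (x_star - x k)
                  + \<theta> * ((f' lam + 2) / \<bar>f' lam\<bar>)) * norm (x_star - x k))
            \<and> (\<theta> < (1 - 2 * sqrt (\<gamma> * b) - \<gamma> * b) / (5 - 2 * sqrt (\<gamma> * b) - \<gamma> * b) \<longrightarrow>
                 (\<forall>k. norm (x_star - x (Suc k)) \<le>
                   ((1 + \<theta>) / 2 + 2 * \<theta> / (1 - 2 * sqrt (\<gamma> * b) - \<gamma> * b)) * norm (x_star - x k)))))"
proof -
  have ball_int: "ball x0 (1 / \<gamma>) \<subseteq> interior C"
    using ball_sub by (rule interior_maximal) simp
  interpret P: smale_gamma_point F D "interior C" x0 \<gamma>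
    using analytic nonsing gamma_pos ball_int by unfold_locales (auto simp: \<gamma>_def)
  interpret M: smale_majorant \<gamma> b
    using gamma_pos b_pos gb by unfold_locales
  have in_int: "x \<in> interior C" if "norm (x - x0) < 1 / \<gamma>" for x
    using that ball_int by (auto simp: dist_norm norm_minus_commute)
  have lam: "lam = M.lam" and tstar: "t_star = M.tstar" and taubar: "\<tau>_bar = M.taubar"
    and kappa: "1 - 2 * sqrt (\<gamma> * b) - \<gamma> * b = M.\<kappa>"
    by (simp_all add: lam_def M.lam_def t_star_def M.tstar_def \<tau>_bar_def M.taubar_def M.\<kappa>_def)
  have Linv: "Linv = P.Linv" by (simp add: Linv_def)
  have "1 + 2 * sqrt (\<gamma> * b) + \<gamma> * b = 2 - M.\<kappa>" by (simp add: M.\<kappa>_def)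
  with theta_le kappa have theta: "\<theta> \<le> M.\<kappa> / (2 - M.\<kappa>)" by (simp only:)
  interpret N: inexact_newton_majorant \<gamma> b P.G P.G' x0 \<theta>
  proof unfold_locales
    show "norm (P.G x0) \<le> b" using init by (simp add: P.G_def Linv)
    show "(P.G has_derivative P.G' x) (at x)" if "norm (x - x0) < 1 / \<gamma>" for x
      by (rule P.has_derivative_G[OF in_int[OF that]])
    show "norm (P.G' x h - h) \<le> (1 / (1 - \<gamma> * t)\<^sup>2 - 1) * norm h"
      if "norm (x - x0) \<le> t" "t < 1 / \<gamma>" for x t h
      using that by (rule P.norm_G'_diff_le)
    show "norm (P.G (x + h) - P.G x - P.G' x h) \<le> \<gamma> * d\<^sup>2 / ((1 - \<gamma> * t)\<^sup>2 * (1 - \<gamma> * (t + d)))"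
      if "norm (x - x0) \<le> t" "norm h \<le> d" "t + d < 1 / \<gamma>" for x h t d
      using that by (rule P.norm_G_remainder_le)
  qed (rule theta_nn, rule theta)
  have step_iff: "inexact_newton_step F (deriv1 D) Linv \<theta> x s
      \<longleftrightarrow> norm (P.G x + P.G' x s) \<le> \<theta> * norm (P.G x)" for x s
    using linear_add[OF bounded_linear.linear[OF P.bounded_linear_Linv], of "F x" "deriv1 D x s"]
    by (simp add: inexact_newton_step_def P.G_def P.G'_def Linv)
  have zero_iff: "F x = 0 \<longleftrightarrow> P.G x = 0" for x
    by (simp add: P.G_def P.Linv_eq_0_iff)
  have f'_lam: "f' lam = - M.\<kappa>" "left_deriv f' lam = 2 * \<gamma> / (1 - \<gamma> * lam) ^ 3"
    unfolding f'_def lam using M.deriv_f[OF M.lam_bounds(2)] M.left_deriv_deriv_f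
    by (simp_all add: M.slope_lam)
  show ?thesis
  proof (intro conjI allI impI)
    fix k and x :: "nat \<Rightarrow> 'a"
    assume "x 0 = x0 \<and> (\<forall>j<k. inexact_newton_step F (deriv1 D) Linv \<theta> (x j) (x (Suc j) - x j))"
    then have dist: "norm (x k - x0) < M.lam" and ex: "\<exists>s. P.G (x k) + P.G' (x k) s = 0"
      using N.newton_well_defined[of x k] by (simp_all add: step_iff)
    show "x k \<in> interior C"
      by (rule in_int[OF order_less_trans[OF dist M.lam_bounds(2)]])
    \<comment> \<open>An exact Newton step meets every nonnegative tolerance.\<close>
    obtain s where "P.G (x k) + P.G' (x k) s = 0" using ex by blast
    then have "inexact_newton_step F (deriv1 D) Linv \<theta> (x k) s"
      using theta_nn by (simp add: step_iff)
    then show "\<exists>s. inexact_newton_step F (deriv1 D) Linv \<theta> (x k) s" by blast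
  next
    fix x :: "nat \<Rightarrow> 'a"
    assume "x 0 = x0 \<and> (\<forall>k. inexact_newton_step F (deriv1 D) Linv \<theta> (x k) (x (Suc k) - x k))"
    then have x_0: "x 0 = x0"
      and x_step: "\<And>k. norm (P.G (x k) + P.G' (x k) (x (Suc k) - x k)) \<le> \<theta> * norm (P.G (x k))"
      by (auto simp: step_iff)
    obtain z where z: "x \<longlonglongrightarrow> z" "P.G z = 0" "\<And>k. norm (z - x k) \<le> M.lam - N.tk k" "norm (z - x0) \<le> M.lam"
      using N.iterates_converge[of x, OF x_0 x_step] by blast
    \<comment> \<open>The limit is known only to lie within \<open>lam\<close> of \<open>x0\<close>.
      As \<open>lam < taubar\<close>, the zero localisation then places it within
      \<open>tstar\<close>, and uniqueness applies to it.\<close>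
    have z_tau: "norm (z - x0) < M.taubar" using z(4) M.lam_less_taubar by simp
    have err: "norm (z - x (Suc k)) \<le>
        ((1 + \<theta>) / 2 * (2 * \<gamma> / (1 - \<gamma> * M.lam) ^ 3 / M.\<kappa>) * norm (z - x k) + \<theta> * ((2 - M.\<kappa>) / M.\<kappa>)) * norm (z - x k)"
      "norm (z - x (Suc k)) \<le> ((1 + \<theta>) / 2 + 2 * \<theta> / M.\<kappa>) * norm (z - x k)" for k
      using N.newton_error[OF N.iterates_bounds(1)[of x k, OF x_0 x_step] N.tk_bounds(1,2) x_step z(2,3)]
      by simp_all
    show "\<exists>x_star. x \<longlonglongrightarrow> x_star \<and> F x_star = 0
            \<and> (\<forall>k. norm (Linv (F (x k))) \<le> ((1 + \<theta>\<^sup>2) / 2) ^ k * b)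
            \<and> (\<forall>k. x k \<in> ball x0 lam)
            \<and> x_star \<in> cball x0 t_star
            \<and> (\<forall>y\<in>ball x0 \<tau>_bar. F y = 0 \<longrightarrow> y = x_star)
            \<and> (\<forall>k. norm (x_star - x (Suc k)) \<le>
                 ((1 + \<theta>) / 2 * (left_deriv f' lam / \<bar>f' lam\<bar>) * norm (x_star - x k)
                  + \<theta> * ((f' lam + 2) / \<bar>f' lam\<bar>)) * norm (x_star - x k))
            \<and> (\<theta> < (1 - 2 * sqrt (\<gamma> * b) - \<gamma> * b) / (5 - 2 * sqrt (\<gamma> * b) - \<gamma> * b) \<longrightarrow>
                 (\<forall>k. norm (x_star - x (Suc k)) \<le>
                   ((1 + \<theta>) / 2 + 2 * \<theta> / (1 - 2 * sqrt (\<gamma> * b) - \<gamma> * b)) * norm (x_star - x k)))"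
    proof (intro exI[of _ z] conjI allI impI ballI)
      show "x \<longlonglongrightarrow> z" "F z = 0" using z by (simp_all add: zero_iff)
      show "norm (Linv (F (x k))) \<le> ((1 + \<theta>\<^sup>2) / 2) ^ k * b" for k
        using N.residual_le[OF x_0 x_step] by (simp add: P.G_def Linv)
      show "x k \<in> ball x0 lam" for k
        using N.newton_well_defined(1)[of x k] x_0 x_step by (simp add: lam dist_norm norm_minus_commute)
      show "z \<in> cball x0 t_star"
        using N.zero_in_cball_tstar[OF z_tau z(2)] by (simp add: tstar dist_norm norm_minus_commute)
      show "y = z" if "y \<in> ball x0 \<tau>_bar" "F y = 0" for y
        using N.zero_unique[of y z] that z_tau z(2)
        by (simp add: taubar zero_iff dist_norm norm_minus_commute)
      show "norm (z - x (Suc k)) \<le>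
          ((1 + \<theta>) / 2 * (left_deriv f' lam / \<bar>f' lam\<bar>) * norm (z - x k)
            + \<theta> * ((f' lam + 2) / \<bar>f' lam\<bar>)) * norm (z - x k)" for k
        using err(1)[of k] M.\<kappa>_pos unfolding f'_lam unfolding lam by simp
      show "norm (z - x (Suc k)) \<le>
          ((1 + \<theta>) / 2 + 2 * \<theta> / (1 - 2 * sqrt (\<gamma> * b) - \<gamma> * b)) * norm (z - x k)" for k
        using err(2)[of k] by (simp only: kappa)
    qed
  qed
qed

end
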